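(* Let $n\ge1$, let $\varphi:\mathbb C^n\to\mathbb R$ be a plurisubharmonic $\mathcal C^\infty$ function, and let $u=\sum_{j=1}^nu_j\,dz_j\in A^2_{(1,0)}(\mathbb C^n,e^{-\varphi})$ with $u\in\mathrm{dom}(\partial)\cap\mathrm{dom}(\partial^*_\varphi)$. Put $v_j=\frac{\partial\varphi}{\partial\overline z_j}u_j$, $V=\sum_{j=1}^nv_j$ and $R_\varphi=I-P_\varphi$. Then the quantity $$\sum_{j,k=1}^n\left(\frac{\partial\varphi}{\partial\overline z_j}u_j-P_\varphi\Big(\frac{\partial\varphi}{\partial\overline z_j}u_j\Big),\ \frac{\partial\varphi}{\partial\overline z_k}u_k\right)_\varphi$$ is always non-negative; moreover it equals $$\sum_{j,k=1}^n\left(\Big[\frac{\partial}{\partial z_k},\frac{\partial\varphi}{\partial\overline z_j}\Big]u_j,u_k\right)_\varphi-\sum_{j,k=1}^n\left(\Big[\frac{\partial}{\partial z_k},P_\varphi\circ\frac{\partial\varphi}{\partial\overline z_j}\Big]u_j,u_k\right)_\varphi=\|R_\varphi v_1+\dots+R_\varphi v_n\|_\varphi^2=\|V\|^2_\varphi-\|P_\varphi V\|^2_\varphi .$$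
   Context: $\lambda$ is Lebesgue measure on $\mathbb C^n$. $L^2(\mathbb C^n,e^{-\varphi})$ has inner product $(f,g)_\varphi=\int_{\mathbb C^n}f\,\overline g\,e^{-\varphi}\,d\lambda$ and norm $\|\cdot\|_\varphi$, and $A^2(\mathbb C^n,e^{-\varphi})$ is its closed subspace of entire functions. It is a reproducing kernel Hilbert space with (Bergman) kernel $K_\varphi(z,w)$, and $P_\varphi:L^2(\mathbb C^n,e^{-\varphi})\to A^2(\mathbb C^n,e^{-\varphi})$ is the orthogonal projection, $P_\varphi F(z)=\int_{\mathbb C^n}K_\varphi(z,w)F(w)e^{-\varphi(w)}\,d\lambda(w)$. $A^2_{(p,0)}(\mathbb C^n,e^{-\varphi})$ is the Hilbert space of $(p,0)$-forms $f=\sum'_{|J|=p}f_J\,dz_J$ (sum over strictly increasing multi-indices $J$) with coefficients $f_J\in A^2(\mathbb C^n,e^{-\varphi})$ and $\|f\|^2_\varphi=\sum'_{|J|=p}\|f_J\|^2_\varphi$. The operator $\partial$ is $\partial f=\sum'_{|J|=p}\sum_{j=1}^n\frac{\partial f_J}{\partial z_j}\,dz_j\wedge dz_J$, with $\mathrm{dom}(\partial)=\{f\in A^2_{(p,0)}(\mathbb C^n,e^{-\varphi}):\partial f\in A^2_{(p+1,0)}(\mathbb C^n,e^{-\varphi})\}$, regarded as a densely defined operator. $\partial^*_\varphi$ is the Hilbert space adjoint of $\partial$, with $\mathrm{dom}(\partial_\varphi^* )=\{g\in A^2_{(p+1,0)}(\mathbb C^n,e^{-\varphi}): f\mapsto(\partial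 f,g)_\varphi\text{ is continuous on }\mathrm{dom}(\partial)\}$. In the commutators, $\frac{\partial\varphi}{\partial\overline z_j}$ denotes the operator of multiplication by that function, and $[A,B]=AB-BA$; thus $\big[\frac{\partial}{\partial z_k},\frac{\partial\varphi}{\partial\overline z_j}\big]u_j=\frac{\partial}{\partial z_k}\big(\frac{\partial\varphi}{\partial\overline z_j}u_j\big)-\frac{\partial\varphi}{\partial\overline z_j}\frac{\partial u_j}{\partial z_k}$ and $\big[\frac{\partial}{\partial z_k},P_\varphi\circ\frac{\partial\varphi}{\partial\overline z_j}\big]u_j=\frac{\partial}{\partial z_k}P_\varphi\big(\frac{\partial\varphi}{\partial\overline z_j}u_j\big)-P_\varphi\big(\frac{\partial\varphi}{\partial\overline z_j}\frac{\partial u_j}{\partial z_k}\big)$.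
   Formalization: Assumes each v_j lies in L²(e^{-φ}), so that P_φ v_j is defined; the commutator formula is claimed only when all (∂φ/∂z̄_j)(∂u_j/∂z_k) lie in L² and the inner products ([∂/∂z_k, P_φ∘∂φ/∂z̄_j]u_j, u_k)_φ exist. *)

theory Defs
  imports "HOL-Analysis.Analysis"
begin

text \<open>
  The space \<open>C^n\<close> is the type \<^typ>\<open>complex^'n\<close> with \<open>n = CARD('n)\<close>; Lebesgue measure on it is
  \<^const>\<open>lborel\<close>. The linear order on the index type is only used to orient forms.
\<close>

type_synonym 'n cfun = "complex^'n \<Rightarrow> complex"


section \<open>Smoothness, Wirtinger derivatives, plurisubharmonicity\<close>

primrec Ck :: "nat \<Rightarrow> ('a::euclidean_space \<Rightarrow> 'b::real_normed_vector) \<Rightarrow> bool" where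
  "Ck 0 f \<longleftrightarrow> continuous_on UNIV f"
| "Ck (Suc k) f \<longleftrightarrow> (\<forall>x. f differentiable (at x)) \<and>
     (\<forall>b\<in>Basis. Ck k (\<lambda>x. frechet_derivative f (at x) b))"

definition smooth :: "('a::euclidean_space \<Rightarrow> 'b::real_normed_vector) \<Rightarrow> bool" where
  "smooth f \<longleftrightarrow> (\<forall>k. Ck k f)"

text \<open>
  With \<open>z_j = x_j + i y_j\<close>, the vectors \<^term>\<open>axis j 1\<close> and \<^term>\<open>axis j \<i>\<close> are the real
  directions of \<open>x_j\<close> and \<open>y_j\<close>.
\<close>

definition dz :: "'n \<Rightarrow> ('n::finite) cfun \<Rightarrow> 'n cfun" where
  "dz j f z = (frechet_derivative f (at z) (axis j 1)
               - \<i> * frechet_derivative f (at z) (axis j \<i>)) / 2"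

definition dzbar :: "'n \<Rightarrow> ('n::finite) cfun \<Rightarrow> 'n cfun" where
  "dzbar j f z = (frechet_derivative f (at z) (axis j 1)
                  + \<i> * frechet_derivative f (at z) (axis j \<i>)) / 2"

definition entire :: "('n::finite) cfun \<Rightarrow> bool" where
  "entire f \<longleftrightarrow> (\<forall>z. \<exists>D. (f has_derivative D) (at z) \<and> (\<forall>c w. D (c *s w) = c * D w))"

text \<open>
  Subharmonicity on every complex line, expressed by the sub-mean value inequality on circles; the
  radius is absorbed in \<open>w\<close>. Only meant for continuous \<open>\<phi>\<close>, for which upper semicontinuity and the
  existence of the circular means are automatic.
\<close>

definition plurisubharmonic :: "(complex^'n::finite \<Rightarrow> real) \<Rightarrow> bool" where
  "plurisubharmonic \<phi> \<longleftrightarrow>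
     (\<forall>z w. \<phi> z \<le> integral {0..2 * pi} (\<lambda>t. \<phi> (z + cis t *s w)) / (2 * pi))"


section \<open>Weighted spaces and the Bergman projection\<close>

definition ip :: "(complex^'n::finite \<Rightarrow> real) \<Rightarrow> 'n cfun \<Rightarrow> 'n cfun \<Rightarrow> complex" where
  "ip \<phi> f g = (LINT z|lborel. f z * cnj (g z) * complex_of_real (exp (- \<phi> z)))"

definition ip_exists :: "(complex^'n::finite \<Rightarrow> real) \<Rightarrow> 'n cfun \<Rightarrow> 'n cfun \<Rightarrow> bool" where
  "ip_exists \<phi> f g \<longleftrightarrow>
     integrable lborel (\<lambda>z. f z * cnj (g z) * complex_of_real (exp (- \<phi> z)))"

definition nrm :: "(complex^'n::finite \<Rightarrow> real) \<Rightarrow> 'n cfun \<Rightarrow> real" where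
  "nrm \<phi> f = sqrt (LINT z|lborel. (cmod (f z))\<^sup>2 * exp (- \<phi> z))"

definition L2 :: "(complex^'n::finite \<Rightarrow> real) \<Rightarrow> 'n cfun set" where
  "L2 \<phi> = {f. f \<in> borel_measurable lborel \<and>
              integrable lborel (\<lambda>z. (cmod (f z))\<^sup>2 * exp (- \<phi> z))}"

definition A2 :: "(complex^'n::finite \<Rightarrow> real) \<Rightarrow> 'n cfun set" where
  "A2 \<phi> = {f \<in> L2 \<phi>. entire f}"

text \<open>
  The orthogonal projection onto \<^term>\<open>A2 \<phi>\<close>. The description picks out a genuine function, not
  merely a class modulo null sets, because members of \<^term>\<open>A2 \<phi>\<close> are continuous. It is
  meaningful for \<open>F \<in> L2 \<phi>\<close>.
\<close>

definition bergman_proj :: "(complex^'n::finite \<Rightarrow> real) \<Rightarrow> 'n cfun \<Rightarrow> 'n cfun" where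
  "bergman_proj \<phi> F = (THE h. h \<in> A2 \<phi> \<and> (\<forall>g\<in>A2 \<phi>. ip \<phi> (\<lambda>z. F z - h z) g = 0))"

definition bergman_compl :: "(complex^'n::finite \<Rightarrow> real) \<Rightarrow> 'n cfun \<Rightarrow> 'n cfun" where
  "bergman_compl \<phi> F = (\<lambda>z. F z - bergman_proj \<phi> F z)"

definition mult_op :: "('n::finite) cfun \<Rightarrow> 'n cfun \<Rightarrow> 'n cfun" where
  "mult_op a f = (\<lambda>z. a z * f z)"

definition commutator ::
  "(('n::finite) cfun \<Rightarrow> 'n cfun) \<Rightarrow> ('n cfun \<Rightarrow> 'n cfun) \<Rightarrow> 'n cfun \<Rightarrow> 'n cfun" where
  "commutator A B f = (\<lambda>z. A (B f) z - B (A f) z)"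

abbreviation phibar :: "(complex^'n::finite \<Rightarrow> real) \<Rightarrow> 'n \<Rightarrow> 'n cfun" where
  "phibar \<phi> j \<equiv> dzbar j (\<lambda>z. complex_of_real (\<phi> z))"


section \<open>The \<open>\<partial>\<close>-complex on holomorphic forms\<close>

text \<open>
  A strictly increasing multi-index \<open>J\<close> of length \<open>p\<close> is identified with the set of its entries;
  \<open>f J\<close> is the coefficient of \<open>dz_J\<close>, and all coefficients with \<^prop>\<open>card J \<noteq> p\<close> vanish.
\<close>

type_synonym 'n form = "'n set \<Rightarrow> 'n cfun"

definition A2_form :: "(complex^'n::finite \<Rightarrow> real) \<Rightarrow> nat \<Rightarrow> 'n form set" where
  "A2_form \<phi> p = {f. \<forall>J. if card J = p then f J \<in> A2 \<phi> else f J = (\<lambda>z. 0)}"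

definition form_ip :: "(complex^'n::finite \<Rightarrow> real) \<Rightarrow> nat \<Rightarrow> 'n form \<Rightarrow> 'n form \<Rightarrow> complex" where
  "form_ip \<phi> p f g = (\<Sum>J | card J = p. ip \<phi> (f J) (g J))"

definition form_norm :: "(complex^'n::finite \<Rightarrow> real) \<Rightarrow> nat \<Rightarrow> 'n form \<Rightarrow> real" where
  "form_norm \<phi> p f = sqrt (\<Sum>J | card J = p. (nrm \<phi> (f J))\<^sup>2)"

text \<open>
  The coefficient of \<open>dz_K\<close> collects the terms \<open>dz_j \<and> dz_J\<close> with \<open>K = J \<union> {j}\<close>, \<open>j \<notin> J\<close>; the
  sign comes from moving \<open>dz_j\<close> past the factors with smaller index.
\<close>

definition del :: "('n::{finite,linorder}) form \<Rightarrow> 'n form" where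
  "del f K = (\<lambda>z. \<Sum>j\<in>K. (-1) ^ card {i \<in> K. i < j} * dz j (f (K - {j})) z)"

definition dom_del :: "(complex^'n::{finite,linorder} \<Rightarrow> real) \<Rightarrow> nat \<Rightarrow> 'n form set" where
  "dom_del \<phi> p = {f \<in> A2_form \<phi> p. del f \<in> A2_form \<phi> (p + 1)}"

text \<open>The domain of the adjoint of \<open>\<partial>\<close> acting from \<open>(p,0)\<close>-forms to \<open>(p+1,0)\<close>-forms.\<close>

definition dom_del_star :: "(complex^'n::{finite,linorder} \<Rightarrow> real) \<Rightarrow> nat \<Rightarrow> 'n form set" where
  "dom_del_star \<phi> p = {g \<in> A2_form \<phi> (p + 1).
     \<forall>f\<in>dom_del \<phi> p. \<forall>\<epsilon>>0. \<exists>\<delta>>0. \<forall>h\<in>dom_del \<phi> p.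
       form_norm \<phi> p (\<lambda>J z. h J z - f J z) < \<delta> \<longrightarrow>
       cmod (form_ip \<phi> (p + 1) (del h) g - form_ip \<phi> (p + 1) (del f) g) < \<epsilon>}"

end

theory Submission
  imports Defs "HOL-Complex_Analysis.Cauchy_Integral_Formula"
begin

text \<open>
  Since \<open>R = I - P\<close> is an orthogonal projection, \<open>(R v\<^sub>j, v\<^sub>k) = (R v\<^sub>j, R v\<^sub>k)\<close>, and summing gives the norm of
  \<open>\<Sum>\<^sub>j R v\<^sub>j = R V\<close>; this needs that the projection exists, i.e. that a minimizing sequence of entire
  functions converges locally uniformly, which is a consequence of a mean value property.

  The difference of the two commutators applied to \<open>u\<^sub>j\<close> is \<open>\<partial>\<^sub>k (R v\<^sub>j) - R (\<phi>\<^sub>j \<partial>\<^sub>k u\<^sub>j)\<close>, where \<open>\<phi>\<^sub>j\<close> is the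
  derivative of \<open>\<phi>\<close> with respect to the conjugate of \<open>z\<^sub>j\<close>. The second term is orthogonal to \<open>u\<^sub>k\<close>, and integrating the first by parts
  against \<open>u\<^sub>k\<close> gives \<open>(R v\<^sub>j, v\<^sub>k)\<close>. No boundary term survives: cut-off functions with gradient
  \<open>O(1/n)\<close> are harmless because \<open>R v\<^sub>j\<close> and \<open>u\<^sub>k\<close> are square integrable. Plurisubharmonicity enters in the
  integrability of \<open>[\<partial>\<^sub>k, \<phi>\<^sub>j] u\<^sub>j\<close> against \<open>u\<^sub>k\<close>: the Levi form is nonnegative, so this term is dominated
  by the diagonal ones, which are integrable by Fatou's lemma.
\<close>


section \<open>Calculus of continuously differentiable functions\<close>

text \<open>Integrability of the commutator terms is the main obstacle. Integration by parts is
  therefore first proved as a limit of cut-off integrals, without assuming that the differentiated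
  term is integrable. That limit feeds Fatou's lemma on the Levi diagonal; the cut-off is removed
  only after integrability is known.

  The mean value property avoids polar coordinates: the rotation field
  \<open>w \<mapsto> i w\<close> is divergence free, and complex linearity of the derivative turns
  radial derivatives into rotational ones, so averaging against a radial bump is enough. It bounds
  point values by the norm, and Cauchy's inequality on complex lines then bounds derivatives.
  Uniform control of derivatives matters because \<open>entire\<close> demands a complex linear
  Frechet derivative, and a limit of such derivatives is again complex linear.

  Since \<open>bergman_proj\<close> selects a function by \<open>THE\<close>, uniqueness must hold
  pointwise and not just almost everywhere; the same evaluation bound provides this.\<close>

definition C1 :: "('a::euclidean_space \<Rightarrow> 'b::real_normed_vector) \<Rightarrow> bool" where
  "C1 f \<longleftrightarrow> (\<forall>x. f differentiable (at x)) \<and>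
     (\<forall>b. continuous_on UNIV (\<lambda>x. frechet_derivative f (at x) b))"

lemma C1_has_derivative:
  "C1 f \<Longrightarrow> (f has_derivative frechet_derivative f (at x)) (at x)"
  by (simp add: C1_def frechet_derivative_works[symmetric])

lemma C1_continuous_derivative:
  "C1 f \<Longrightarrow> continuous_on UNIV (\<lambda>x. frechet_derivative f (at x) b)"
  by (simp add: C1_def)

lemma frechet_derivative_eqI:
  "(f has_derivative D) (at x) \<Longrightarrow> frechet_derivative f (at x) b = D b"
  using frechet_derivative_at by metis

lemma C1I:
  assumes "\<And>x. (f has_derivative D x) (at x)"
    and "\<And>b. continuous_on UNIV (\<lambda>x. D x b)"
  shows "C1 f"
  using assms by (auto simp: C1_def differentiable_def frechet_derivative_eqI[OF assms(1)])

lemma C1_continuous: "C1 f \<Longrightarrow> continuous_on UNIV f"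
  by (meson C1_has_derivative continuous_at_imp_continuous_on has_derivative_continuous)

lemma C1_linear: "C1 f \<Longrightarrow> linear (frechet_derivative f (at x))"
  using C1_has_derivative has_derivative_linear by blast

lemma C1_derivative_Basis:
  assumes "C1 f"
  shows "frechet_derivative f (at x) w = (\<Sum>b\<in>Basis. (w \<bullet> b) *\<^sub>R frechet_derivative f (at x) b)"
proof -
  interpret linear "frechet_derivative f (at x)" by (rule C1_linear[OF assms])
  have "frechet_derivative f (at x) w = frechet_derivative f (at x) (\<Sum>b\<in>Basis. (w \<bullet> b) *\<^sub>R b)"
    by (simp add: euclidean_representation)
  then show ?thesis by (simp add: sum scale)
qed

text \<open>Expanding the direction in the finite basis reduces the claim to fixed directions. It
  supplies the joint continuity that differentiation under the integral sign requires when base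
  point and direction both move.\<close>

lemma C1_continuous_derivative_joint:
  fixes f :: "'a::euclidean_space \<Rightarrow> 'b::real_normed_vector"
    and p w :: "'c::topological_space \<Rightarrow> 'a"
  assumes "C1 f" "continuous_on S p" "continuous_on S w"
  shows "continuous_on S (\<lambda>y. frechet_derivative f (at (p y)) (w y))"
proof -
  have c: "continuous_on S (\<lambda>y. frechet_derivative f (at (p y)) b)" for b
    by (rule continuous_on_compose2[OF C1_continuous_derivative[OF assms(1)] assms(2)]) simp
  have "continuous_on S (\<lambda>y. \<Sum>b\<in>Basis. (w y \<bullet> b) *\<^sub>R frechet_derivative f (at (p y)) b)"
    by (intro continuous_on_sum continuous_on_scaleR continuous_on_inner assms c continuous_on_const)
  then show ?thesis
    by (rule continuous_on_eq) (rule C1_derivative_Basis[OF assms(1), symmetric])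
qed

text \<open>\<open>Ck\<close> recurses along basis vectors only. Continuity of the partial
  derivatives is the definition for \<open>k = 0\<close> and follows from their differentiability
  for larger \<open>k\<close>; linearity extends it to all directions.\<close>

lemma Ck_Suc_imp_C1:
  assumes "Ck (Suc k) f"
  shows "C1 f"
proof -
  have d: "\<And>x. f differentiable (at x)" and B: "\<And>b. b \<in> Basis \<Longrightarrow> Ck k (\<lambda>x. frechet_derivative f (at x) b)"
    using assms by auto
  have c: "continuous_on UNIV (\<lambda>x. frechet_derivative f (at x) b)" if "b \<in> Basis" for b
  proof (cases k)
    case 0
    then show ?thesis using B[OF that] by simp
  next
    case (Suc m)
    then show ?thesis using B[OF that]
      by (auto intro!: continuous_at_imp_continuous_on differentiable_imp_continuous_within)
  qed
  have "continuous_on UNIV (\<lambda>x. frechet_derivative f (at x) b)" for b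
  proof -
    have "frechet_derivative f (at x) b = (\<Sum>i\<in>Basis. (b \<bullet> i) *\<^sub>R frechet_derivative f (at x) i)" for x
    proof -
      have lin: "linear (frechet_derivative f (at x))"
        using d linear_frechet_derivative by blast
      have "frechet_derivative f (at x) b = frechet_derivative f (at x) (\<Sum>i\<in>Basis. (b \<bullet> i) *\<^sub>R i)"
        by (simp add: euclidean_representation)
      then show ?thesis by (simp add: linear_sum[OF lin] linear_scale[OF lin])
    qed
    moreover have "continuous_on UNIV (\<lambda>x. \<Sum>i\<in>Basis. (b \<bullet> i) *\<^sub>R frechet_derivative f (at x) i)"
      by (intro continuous_intros c)
    ultimately show ?thesis by simp
  qed
  with d show ?thesis by (simp add: C1_def)
qed

lemma C1_bounded_linear:
  assumes "C1 f" "bounded_linear L"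
  shows "C1 (\<lambda>x. L (f x))"
proof (rule C1I)
  show "((\<lambda>x. L (f x)) has_derivative (\<lambda>b. L (frechet_derivative f (at x) b))) (at x)" for x
    by (rule bounded_linear.has_derivative[OF assms(2) C1_has_derivative[OF assms(1)]])
  show "continuous_on UNIV (\<lambda>x. L (frechet_derivative f (at x) b))" for b
    by (intro bounded_linear.continuous_on[OF assms(2)] C1_continuous_derivative assms(1))
qed

lemma C1_scaleR:
  fixes f :: "'a::euclidean_space \<Rightarrow> real" and g :: "'a \<Rightarrow> 'b::real_normed_vector"
  assumes "C1 f" "C1 g"
  shows "C1 (\<lambda>x. f x *\<^sub>R g x)"
proof (rule C1I)
  show "((\<lambda>x. f x *\<^sub>R g x) has_derivative
     (\<lambda>b. f x *\<^sub>R frechet_derivative g (at x) b + frechet_derivative f (at x) b *\<^sub>R g x)) (at x)" for x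
    by (rule has_derivative_scaleR[OF C1_has_derivative[OF assms(1)] C1_has_derivative[OF assms(2)]])
  show "continuous_on UNIV (\<lambda>x. f x *\<^sub>R frechet_derivative g (at x) b + frechet_derivative f (at x) b *\<^sub>R g x)" for b
    by (intro continuous_intros C1_continuous C1_continuous_derivative assms)
qed

lemma C1_mult:
  fixes f g :: "'a::euclidean_space \<Rightarrow> 'b::real_normed_algebra"
  assumes "C1 f" "C1 g"
  shows "C1 (\<lambda>x. f x * g x)"
proof (rule C1I)
  show "((\<lambda>x. f x * g x) has_derivative
     (\<lambda>b. f x * frechet_derivative g (at x) b + frechet_derivative f (at x) b * g x)) (at x)" for x
    by (rule has_derivative_mult[OF C1_has_derivative[OF assms(1)] C1_has_derivative[OF assms(2)]])
  show "continuous_on UNIV (\<lambda>x. f x * frechet_derivative g (at x) b + frechet_derivative f (at x) b * g x)" for b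
    by (intro continuous_intros C1_continuous C1_continuous_derivative assms)
qed

lemma C1_diff:
  assumes "C1 f" "C1 g"
  shows "C1 (\<lambda>x. f x - g x)"
proof (rule C1I)
  show "((\<lambda>x. f x - g x) has_derivative
     (\<lambda>b. frechet_derivative f (at x) b - frechet_derivative g (at x) b)) (at x)" for x
    by (rule has_derivative_diff[OF C1_has_derivative[OF assms(1)] C1_has_derivative[OF assms(2)]])
  show "continuous_on UNIV (\<lambda>x. frechet_derivative f (at x) b - frechet_derivative g (at x) b)" for b
    by (intro continuous_intros C1_continuous_derivative assms)
qed

lemma C1_add:
  assumes "C1 f" "C1 g"
  shows "C1 (\<lambda>x. f x + g x)"
proof (rule C1I)
  show "((\<lambda>x. f x + g x) has_derivative
     (\<lambda>b. frechet_derivative f (at x) b + frechet_derivative g (at x) b)) (at x)" for x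
    by (rule has_derivative_add[OF C1_has_derivative[OF assms(1)] C1_has_derivative[OF assms(2)]])
  show "continuous_on UNIV (\<lambda>x. frechet_derivative f (at x) b + frechet_derivative g (at x) b)" for b
    by (intro continuous_intros C1_continuous_derivative assms)
qed

lemma C1_const: "C1 (\<lambda>x. c)"
  by (rule C1I[where D="\<lambda>x b. 0"]) auto

lemma C1_sum:
  assumes "\<And>i. i \<in> I \<Longrightarrow> C1 (f i)"
  shows "C1 (\<lambda>x. \<Sum>i\<in>I. f i x)"
proof (cases "finite I")
  case True
  then show ?thesis using assms by (induction I) (auto intro: C1_add C1_const)
qed (simp add: C1_const)

lemma C1_scaleR_argument:
  assumes "C1 f"
  shows "C1 (\<lambda>x. f (c *\<^sub>R x))"
    and "frechet_derivative (\<lambda>x. f (c *\<^sub>R x)) (at x) b = c *\<^sub>R frechet_derivative f (at (c *\<^sub>R x)) b"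
proof -
  have h: "((\<lambda>x. f (c *\<^sub>R x)) has_derivative (\<lambda>b. frechet_derivative f (at (c *\<^sub>R x)) (c *\<^sub>R b))) (at x)" for x
    by (rule has_derivative_compose[OF _ C1_has_derivative[OF assms]])
       (auto intro!: derivative_eq_intros)
  show "C1 (\<lambda>x. f (c *\<^sub>R x))"
    by (rule C1I[OF h]) (intro C1_continuous_derivative_joint assms continuous_intros)
  show "frechet_derivative (\<lambda>x. f (c *\<^sub>R x)) (at x) b = c *\<^sub>R frechet_derivative f (at (c *\<^sub>R x)) b"
    using frechet_derivative_eqI[OF h] linear_scale[OF C1_linear[OF assms]] by metis
qed

section \<open>Integrals of compactly supported functions\<close>

text \<open>Links the Lebesgue integral over the whole space, which is translation invariant, with
  the integral over a box, for which the Leibniz rule is available.\<close>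

lemma continuous_compact_support_integrable:
  fixes g :: "'a::euclidean_space \<Rightarrow> 'b::euclidean_space"
  assumes c: "continuous_on UNIV g" and z: "\<And>x. x \<notin> cbox a b \<Longrightarrow> g x = 0"
  shows "integrable lborel g" "(LINT x|lborel. g x) = integral (cbox a b) g"
proof -
  have "integrable lborel (\<lambda>x. indicator (cbox a b) x *\<^sub>R g x)"
    by (rule borel_integrable_compact) (auto intro: continuous_on_subset[OF c])
  moreover have eq: "(\<lambda>x. indicator (cbox a b) x *\<^sub>R g x) = g"
    using z by (auto simp: fun_eq_iff indicator_def)
  ultimately show i: "integrable lborel g" by simp
  have "(g has_integral (LINT x|lborel. g x)) UNIV"
    by (rule has_integral_integral_lborel[OF i])
  moreover have "(\<lambda>x. if x \<in> cbox a b then g x else 0) = g"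
    using z by auto
  ultimately have "(g has_integral (LINT x|lborel. g x)) (cbox a b)"
    using has_integral_restrict_UNIV[of "cbox a b" g] by simp
  then show "(LINT x|lborel. g x) = integral (cbox a b) g"
    by (simp add: integral_unique)
qed

lemma norm_gt_of_notin_cbox:
  fixes x :: "'a::euclidean_space"
  assumes "x \<notin> cbox (- (r *\<^sub>R One)) (r *\<^sub>R One)"
  shows "r < norm x"
proof -
  obtain i where "i \<in> Basis" "\<not> (- r \<le> x \<bullet> i \<and> x \<bullet> i \<le> r)"
    using assms by (auto simp: mem_box)
  with Basis_le_norm[of i x] show ?thesis by auto
qed

lemma integral_translate:
  fixes g :: "'a::euclidean_space \<Rightarrow> 'b::euclidean_space"
  assumes [measurable]: "g \<in> borel_measurable borel"
  shows "(LINT x|lborel. g (x + c)) = (LINT x|lborel. g x)"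
proof -
  have "(LINT x|lborel. g x) = (LINT x|distr lborel borel ((+) c). g x)"
    by (simp add: lborel_distr_plus)
  also have "\<dots> = (LINT x|lborel. g (c + x))"
    by (rule integral_distr) auto
  finally show ?thesis by (simp add: add.commute)
qed

text \<open>Differentiate the translation invariant integral along \<open>b\<close>.\<close>

lemma integral_derivative_eq_0:
  fixes F :: "'a::euclidean_space \<Rightarrow> 'b::euclidean_space"
  assumes F: "C1 F" and z: "\<And>x. r \<le> norm x \<Longrightarrow> F x = 0"
  shows "integrable lborel (\<lambda>x. frechet_derivative F (at x) b)"
    and "(LINT x|lborel. frechet_derivative F (at x) b) = 0"
proof -
  \<comment> \<open>The extra \<open>norm b\<close> keeps the supports of all translates by
    \<open>t *\<^sub>R b\<close> with \<open>\<bar>t\<bar> < 1\<close> inside one fixed box.\<close>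
  define s where "s = \<bar>r\<bar> + norm b"
  define l u :: 'a where "l = - (s *\<^sub>R One)" and "u = s *\<^sub>R One"
  have out: "s < norm x" if "x \<notin> cbox l u" for x
    using that norm_gt_of_notin_cbox unfolding l_def u_def by blast
  have Fz: "F (x + t *\<^sub>R b) = 0" if "x \<notin> cbox l u" "\<bar>t\<bar> < 1" for x t
  proof (rule z)
    have "norm x \<le> norm (x + t *\<^sub>R b) + norm (t *\<^sub>R b)"
      using norm_triangle_ineq4[of "x + t *\<^sub>R b" "t *\<^sub>R b"] by simp
    moreover have "norm (t *\<^sub>R b) \<le> norm b" using that(2) mult_right_mono[of "\<bar>t\<bar>" 1 "norm b"] by simp
    ultimately show "r \<le> norm (x + t *\<^sub>R b)" using out[OF that(1)] unfolding s_def by linarith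
  qed
  have Dz: "frechet_derivative F (at x) b = 0" if "x \<notin> cbox l u" for x
  proof -
    have "open {x. r < norm x}" by (intro open_Collect_less continuous_intros)
    moreover have "x \<in> {x. r < norm x}" using out[OF that] by (simp add: s_def) (use norm_ge_zero[of b] in linarith)
    ultimately have "(F has_derivative (\<lambda>_. 0)) (at x)"
      using has_derivative_transform_within_open[of "\<lambda>_. 0" "\<lambda>_. 0" x UNIV "{x. r < norm x}" F] z by auto
    then show ?thesis by (rule frechet_derivative_eqI)
  qed
  note D = continuous_compact_support_integrable[OF C1_continuous_derivative[OF F] Dz]
  show "integrable lborel (\<lambda>x. frechet_derivative F (at x) b)" by (rule D(1))
  define I where "I t = integral (cbox l u) (\<lambda>x. F (x + t *\<^sub>R b))" for t :: real
  have cF: "continuous_on S (\<lambda>x. F (p x))" if "continuous_on S p" for S p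
    by (rule continuous_on_compose2[OF C1_continuous[OF F] that]) auto
  have "I t = (LINT x|lborel. F x)" if "\<bar>t\<bar> < 1" for t
  proof -
    have "I t = (LINT x|lborel. F (x + t *\<^sub>R b))"
      unfolding I_def by (rule continuous_compact_support_integrable(2)[symmetric])
        (auto intro!: cF continuous_intros Fz that)
    then show ?thesis
      using integral_translate[OF borel_measurable_continuous_onI[OF C1_continuous[OF F]]] by simp
  qed
  then have "(I has_vector_derivative 0) (at 0 within {-1<..<1})"
    by (intro has_vector_derivative_transform[OF _ _ has_vector_derivative_const[of "LINT x|lborel. F x"]]) auto
  moreover have "(I has_vector_derivative integral (cbox l u) (\<lambda>x. frechet_derivative F (at (x + 0 *\<^sub>R b)) b))
      (at 0 within {-1<..<1})"
    unfolding I_def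
  proof (rule leibniz_rule_vector_derivative[where fx="\<lambda>t x. frechet_derivative F (at (x + t *\<^sub>R b)) b"])
    fix t :: real and x :: 'a
    have "((\<lambda>t. F (x + t *\<^sub>R b)) has_derivative (\<lambda>h. frechet_derivative F (at (x + t *\<^sub>R b)) (h *\<^sub>R b))) (at t within {-1<..<1})"
      by (rule has_derivative_compose[OF _ C1_has_derivative[OF F]])
         (auto intro!: derivative_eq_intros)
    then show "((\<lambda>t. F (x + t *\<^sub>R b)) has_vector_derivative frechet_derivative F (at (x + t *\<^sub>R b)) b) (at t within {-1<..<1})"
      unfolding has_vector_derivative_def linear_scale[OF C1_linear[OF F]] .
  next
    show "(\<lambda>x. F (x + t *\<^sub>R b)) integrable_on cbox l u" for t
      by (intro integrable_continuous cF continuous_intros)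
    show "continuous_on ({-1<..<1} \<times> cbox l u) (\<lambda>(t, x). frechet_derivative F (at (x + t *\<^sub>R b)) b)"
      unfolding split_beta by (intro C1_continuous_derivative_joint F continuous_intros)
  qed auto
  ultimately have "integral (cbox l u) (\<lambda>x. frechet_derivative F (at x) b) = 0"
    using vector_derivative_unique_at[of I 0 0] by (simp add: at_within_open[of 0 "{-1<..<1::real}"])
  then show "(LINT x|lborel. frechet_derivative F (at x) b) = 0"
    using D(2) by simp
qed

section \<open>A radial bump function\<close>

text \<open>The square makes the truncation continuously differentiable across the unit sphere,
  which is enough for a single integration by parts. Dependence on \<open>x \<bullet> x\<close>
  alone makes the derivative vanish along rotations.\<close>

definition bump :: "'a::euclidean_space \<Rightarrow> real" where
  "bump x = (max 0 (1 - x \<bullet> x))\<^sup>2"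

lemma has_real_derivative_max_0_power2:
  "((\<lambda>t. (max 0 t)\<^sup>2) has_real_derivative 2 * max 0 t) (at (t::real))"
proof -
  consider "t < 0" | "t = 0" | "t > 0" by linarith
  then show ?thesis
  proof cases
    case 1
    have "((\<lambda>t. 0) has_real_derivative 2 * max 0 t) (at t)" using 1 by simp
    then show ?thesis
      by (rule has_field_derivative_transform_within_open[where S="{..<0}"]) (use 1 in auto)
  next
    case 2
    have "(\<lambda>y. (max 0 y)\<^sup>2 / y) \<midarrow>0\<rightarrow> (0::real)"
    proof (rule Lim_null_comparison)
      show "\<forall>\<^sub>F y in at 0. norm ((max 0 y)\<^sup>2 / y) \<le> \<bar>y\<bar>"
        by (rule always_eventually) (auto simp: max_def power2_eq_square)
      show "(\<lambda>y. \<bar>y\<bar>) \<midarrow>0\<rightarrow> (0::real)" by (auto intro!: tendsto_eq_intros)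
    qed
    with 2 show ?thesis by (simp add: DERIV_def)
  next
    case 3
    have "((\<lambda>t. t\<^sup>2) has_real_derivative 2 * max 0 t) (at t)" using 3 by (auto intro!: derivative_eq_intros)
    then show ?thesis
      by (rule has_field_derivative_transform_within_open[where S="{0<..}"]) (use 3 in auto)
  qed
qed

lemma bump_has_derivative:
  "(bump has_derivative (\<lambda>b. - 4 * max 0 (1 - x \<bullet> x) * (x \<bullet> b))) (at x)"
proof -
  have "((\<lambda>x. 1 - x \<bullet> x) has_derivative (\<lambda>b. - (2 * (x \<bullet> b)))) (at x)"
    by (auto intro!: derivative_eq_intros simp: inner_commute)
  from has_derivative_compose[OF this has_real_derivative_max_0_power2[unfolded has_field_derivative_def]]
  show ?thesis by (simp add: bump_def[abs_def] mult_ac)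
qed

lemma frechet_derivative_bump:
  "frechet_derivative bump (at x) b = - 4 * max 0 (1 - x \<bullet> x) * (x \<bullet> b)"
  by (rule frechet_derivative_eqI[OF bump_has_derivative])

lemma C1_bump: "C1 bump"
  by (rule C1I[OF bump_has_derivative]) (intro continuous_intros)

lemma bump_nonneg: "0 \<le> bump x" by (simp add: bump_def)

lemma bump_le_1: "bump x \<le> 1"
  by (simp add: bump_def power_le_one)

lemma bump_eq_0: "1 \<le> norm x \<Longrightarrow> bump x = 0"
  by (simp add: bump_def dot_square_norm one_le_power)

lemma bump_0 [simp]: "bump 0 = 1" by (simp add: bump_def)

lemma norm_frechet_derivative_bump_le: "\<bar>frechet_derivative bump (at x) b\<bar> \<le> 4 * norm b"
proof (cases "x \<bullet> x \<le> 1")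
  case True
  have "norm x \<le> 1" using True by (simp add: dot_square_norm power2_le_iff_abs_le abs_square_le_1)
  then have "\<bar>x \<bullet> b\<bar> \<le> norm b"
    using Cauchy_Schwarz_ineq2[of x b] mult_right_mono[of "norm x" 1 "norm b"] by simp
  moreover have "max 0 (1 - x \<bullet> x) \<le> 1" "0 \<le> max 0 (1 - x \<bullet> x)" by auto
  ultimately have "max 0 (1 - x \<bullet> x) * \<bar>x \<bullet> b\<bar> \<le> 1 * norm b" by (intro mult_mono) auto
  then show ?thesis by (simp add: frechet_derivative_bump abs_mult)
qed (simp add: frechet_derivative_bump)

lemma bump_integrable: "integrable lborel (bump :: 'a::euclidean_space \<Rightarrow> real)"
  by (rule continuous_compact_support_integrable(1)[OF C1_continuous[OF C1_bump],
        of "- (1 *\<^sub>R One)" "1 *\<^sub>R One"])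
     (use norm_gt_of_notin_cbox[of _ 1] bump_eq_0 in \<open>metis less_imp_le\<close>)

lemma bump_integral_pos: "0 < (LINT x|lborel. bump (x::'a::euclidean_space))"
proof -
  have "(LINT x|lborel. bump (x::'a)) \<noteq> 0"
  proof
    assume "(LINT x|lborel. bump (x::'a)) = 0"
    then have "AE x in lborel. bump (x::'a) = 0"
      using integral_nonneg_eq_0_iff_AE[OF bump_integrable] bump_nonneg by auto
    then have "AE x in lborel. x \<notin> ball (0::'a) 1"
    proof eventually_elim
      case (elim x)
      then have "\<not> x \<bullet> x < 1" by (auto simp: bump_def max_def split: if_splits)
      then show ?case by (auto simp: dot_square_norm abs_square_less_1)
    qed
    then have "emeasure lborel (ball (0::'a) 1) = 0"
      by (subst (asm) AE_iff_measurable[OF _ refl]) (auto simp: ball_def)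
    then show False
      using content_ball_pos[of 1 "0::'a"] by (simp add: measure_def)
  qed
  moreover have "0 \<le> (LINT x|lborel. bump (x::'a))" by (simp add: bump_nonneg)
  ultimately show ?thesis by linarith
qed


section \<open>Entire functions\<close>

lemma bounded_linear_complex_vector_mult: "bounded_linear (\<lambda>c. c *s (w :: complex^'n))"
  by (rule linear_conv_bounded_linear[THEN iffD1], rule linearI)
     (simp_all add: vec_eq_iff algebra_simps)

lemma bounded_linear_complex_scalar_mult: "bounded_linear (\<lambda>w. c *s (w :: complex^'n))"
  by (rule linear_conv_bounded_linear[THEN iffD1], rule linearI)
     (simp_all add: vec_eq_iff algebra_simps)

lemma inner_complex_vector: "(x :: complex^'n) \<bullet> y = (\<Sum>i\<in>UNIV. Re (x $ i * cnj (y $ i)))"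
  by (simp add: inner_vec_def inner_complex_def)

lemma norm_complex_scalar_mult: "norm (c *s (w :: complex^'n)) = cmod c * norm w"
  by (simp add: norm_vec_def norm_mult L2_set_right_distrib)

text \<open>Multiplication by i generates the rotations \<open>cis t *s x\<close>, which preserve
  spheres; this is the skewness used for the mean value property.\<close>

lemma inner_ii_mult: "(\<i> *s (x :: complex^'n)) \<bullet> x = 0"
  by (simp add: inner_complex_vector)

lemma entire_has_derivative:
  "entire f \<Longrightarrow> (f has_derivative frechet_derivative f (at z)) (at z)"
  unfolding entire_def using frechet_derivative_at by metis

lemma entire_derivative_complex_linear:
  "entire f \<Longrightarrow> frechet_derivative f (at z) (c *s w) = c * frechet_derivative f (at z) w"
  unfolding entire_def using frechet_derivative_at by metis

lemma entire_continuous: "entire f \<Longrightarrow> continuous_on UNIV f"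
  by (meson entire_has_derivative continuous_at_imp_continuous_on has_derivative_continuous)

text \<open>Complex linearity of the derivative becomes complex differentiability on each complex
  line; this is how one-variable function theory enters.\<close>

lemma entire_line_has_field_derivative:
  assumes "entire f"
  shows "((\<lambda>\<zeta>. f (z + \<zeta> *s w)) has_field_derivative
     frechet_derivative f (at (z + \<zeta> *s w)) w) (at \<zeta>)"
proof -
  have "((\<lambda>\<zeta>. z + \<zeta> *s w) has_derivative (\<lambda>h. h *s w)) (at \<zeta>)"
    by (auto intro!: derivative_eq_intros bounded_linear.has_derivative[OF bounded_linear_complex_vector_mult])
  from has_derivative_compose[OF this entire_has_derivative[OF assms]]
  show ?thesis
    unfolding has_field_derivative_def entire_derivative_complex_linear[OF assms]
    by (simp add: mult.commute[of _ "frechet_derivative f (at (z + \<zeta> *s w)) w"])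
qed

lemma entire_mult:
  assumes "entire f" "entire g"
  shows "entire (\<lambda>z. f z * g z)"
  unfolding entire_def
proof (intro allI exI conjI)
  fix z
  show "((\<lambda>z. f z * g z) has_derivative (\<lambda>h. f z * frechet_derivative g (at z) h
      + frechet_derivative f (at z) h * g z)) (at z)"
    by (rule has_derivative_mult[OF entire_has_derivative[OF assms(1)] entire_has_derivative[OF assms(2)]])
qed (simp add: entire_derivative_complex_linear assms algebra_simps)

lemma entire_add_scaled:
  assumes "entire f" "entire g"
  shows "entire (\<lambda>z. f z + c * g z)"
  unfolding entire_def
proof (intro allI exI conjI)
  fix z
  show "((\<lambda>z. f z + c * g z) has_derivative (\<lambda>h. frechet_derivative f (at z) h
      + c * frechet_derivative g (at z) h)) (at z)"
    by (intro has_derivative_add has_derivative_mult_right entire_has_derivative assms)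
qed (simp add: entire_derivative_complex_linear assms algebra_simps)

lemma entire_0: "entire (\<lambda>z. 0)"
  unfolding entire_def by (intro allI exI[of _ "\<lambda>_. 0"]) auto

lemma entire_translate:
  assumes "entire f"
  shows "entire (\<lambda>w. f (z + w))"
  unfolding entire_def
proof (intro allI exI conjI)
  fix w
  show "((\<lambda>w. f (z + w)) has_derivative frechet_derivative f (at (z + w))) (at w)"
    by (rule has_derivative_compose[OF _ entire_has_derivative[OF assms]])
       (auto intro!: derivative_eq_intros)
qed (simp add: entire_derivative_complex_linear assms algebra_simps)

text \<open>Cauchy's inequality on the complex line through \<open>z\<close> in direction \<open>w\<close>.\<close>

lemma entire_derivative_bound:
  assumes "entire f" and B: "\<And>\<zeta>. cmod \<zeta> = 1 \<Longrightarrow> cmod (f (z + \<zeta> *s w)) \<le> B"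
  shows "cmod (frechet_derivative f (at z) w) \<le> B"
proof -
  let ?g = "\<lambda>\<zeta>. f (z + \<zeta> *s w)"
  note d = entire_line_has_field_derivative[OF assms(1)]
  have hol: "?g holomorphic_on UNIV"
    using d holomorphic_on_open[of UNIV] by blast
  have "norm ((deriv ^^ 1) ?g 0) \<le> fact 1 * B / 1 ^ 1"
    by (rule Cauchy_inequality)
       (auto intro: holomorphic_on_subset[OF hol] holomorphic_on_imp_continuous_on B)
  moreover have "deriv ?g 0 = frechet_derivative f (at z) w"
    using DERIV_imp_deriv[OF d[of z w 0]] by simp
  ultimately show ?thesis by simp
qed

text \<open>\<open>entire\<close> asks for pointwise differentiability only. The derivatives at
  \<open>y\<close> and \<open>z\<close> differ by the derivative at 0 of
  \<open>f (y + x) - f (z + x)\<close>, and Cauchy's bound estimates it by the uniform continuity of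
  \<open>f\<close> on a compact ball.\<close>

lemma entire_C1:
  assumes f: "entire f"
  shows "C1 f"
proof (rule C1I[OF entire_has_derivative[OF f]])
  fix w :: "complex^'a"
  show "continuous_on UNIV (\<lambda>z. frechet_derivative f (at z) w)"
    unfolding continuous_on_iff
  proof (intro ballI allI impI)
    fix z :: "complex^'a" and e :: real
    assume "0 < e"
    \<comment> \<open>The radius leaves room for the circles of radius \<open>norm w\<close> around
      every \<open>y\<close> at distance less than 1 from \<open>z\<close>.\<close>
    let ?K = "cball z (1 + norm w)"
    have "uniformly_continuous_on ?K f"
      by (intro compact_uniformly_continuous continuous_on_subset[OF entire_continuous[OF f]]) auto
    then obtain d where d: "d > 0" "\<And>x y. x \<in> ?K \<Longrightarrow> y \<in> ?K \<Longrightarrow> dist y x < d \<Longrightarrow> dist (f y) (f x) < e / 2"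
      unfolding uniformly_continuous_on_def using \<open>0 < e\<close> by (meson half_gt_zero)
    show "\<exists>d>0. \<forall>y\<in>UNIV. dist y z < d \<longrightarrow> dist (frechet_derivative f (at y) w) (frechet_derivative f (at z) w) < e"
    proof (intro exI[of _ "min d 1"] conjI ballI impI)
      fix y assume y: "dist y z < min d 1"
      have tr: "((\<lambda>x. f (y + x)) has_derivative frechet_derivative f (at y)) (at 0)" for y
        by (rule has_derivative_compose[of "(+) y" "\<lambda>x. x" 0 UNIV f "frechet_derivative f (at y)"])
           (use entire_has_derivative[OF f, of y] in \<open>auto intro!: derivative_eq_intros\<close>)
      let ?h = "\<lambda>x. f (y + x) + (-1) * f (z + x)"
      have h: "entire ?h" by (intro entire_add_scaled entire_translate f)
      have "cmod (frechet_derivative ?h (at 0) w) \<le> e / 2"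
      proof (rule entire_derivative_bound[OF h])
        fix \<zeta> :: complex assume 1: "cmod \<zeta> = 1"
        have "dist (f (y + \<zeta> *s w)) (f (z + \<zeta> *s w)) < e / 2"
        proof (rule d(2))
          show "z + \<zeta> *s w \<in> ?K" by (simp add: dist_norm norm_complex_scalar_mult 1)
          have "norm (y - z + \<zeta> *s w) \<le> norm (y - z) + norm (\<zeta> *s w)" by (rule norm_triangle_ineq)
          then show "y + \<zeta> *s w \<in> ?K"
            using y by (simp add: mem_cball norm_minus_commute[of z] dist_norm norm_complex_scalar_mult 1 algebra_simps)
          show "dist (y + \<zeta> *s w) (z + \<zeta> *s w) < d" using y by simp
        qed
        then show "cmod (f (y + (0 + \<zeta> *s w)) + (-1) * f (z + (0 + \<zeta> *s w))) \<le> e / 2" by (simp add: dist_norm)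
      qed
      moreover have "(?h has_derivative (\<lambda>b. frechet_derivative f (at y) b + (-1) * frechet_derivative f (at z) b)) (at 0)"
        by (intro has_derivative_add has_derivative_mult_right tr)
      ultimately show "dist (frechet_derivative f (at y) w) (frechet_derivative f (at z) w) < e"
        using \<open>0 < e\<close> by (simp add: frechet_derivative_eqI dist_norm)
    qed (use d in auto)
  qed
qed

text \<open>The field \<open>J\<close> is divergence free and tangent to the level sets of the bump function.\<close>

lemma integral_bump_skew_derivative:
  fixes k :: "'a::euclidean_space \<Rightarrow> complex"
  assumes k: "C1 k" and J: "linear J" and skew: "\<And>x. J x \<bullet> x = 0"
  shows "(LINT w|lborel. bump w *\<^sub>R frechet_derivative k (at w) (J w)) = 0"
proof -
  \<comment> \<open>\<open>F b\<close> is the component along \<open>b\<close> of the field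
    \<open>bump * k * J\<close>. The sum over \<open>b\<close> of its derivatives along
    \<open>b\<close> is the divergence, to which the derivative of \<open>J\<close> contributes
    nothing because \<open>J b \<bullet> b = 0\<close>.\<close>
  define F where "F b w = (J w \<bullet> b) *\<^sub>R (bump w *\<^sub>R k w)" for b w
  have blJ: "bounded_linear J" using J by (simp add: linear_conv_bounded_linear)
  have dJ: "((\<lambda>w. J w \<bullet> b) has_derivative (\<lambda>h. J h \<bullet> b)) (at w)" for b w
    by (auto intro!: derivative_eq_intros bounded_linear.has_derivative[OF blJ])
  have cJ: "continuous_on S (\<lambda>x. J (p x))" if "continuous_on S p" for S and p :: "'a \<Rightarrow> 'a"
    by (rule bounded_linear.continuous_on[OF blJ that])
  have C: "C1 (F b)" for b
    unfolding F_def[abs_def]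
    by (intro C1_scaleR C1_bump k C1I[OF dJ]) auto
  have "(F b has_derivative (\<lambda>h. (J w \<bullet> b) *\<^sub>R (bump w *\<^sub>R frechet_derivative k (at w) h
      + frechet_derivative bump (at w) h *\<^sub>R k w) + (J h \<bullet> b) *\<^sub>R (bump w *\<^sub>R k w))) (at w)" for b w
    unfolding F_def[abs_def]
    by (intro has_derivative_scaleR dJ C1_has_derivative C1_bump k)
  note dF = this
  have D: "frechet_derivative (F b) (at w) b = (J w \<bullet> b) *\<^sub>R (bump w *\<^sub>R frechet_derivative k (at w) b
      + frechet_derivative bump (at w) b *\<^sub>R k w)" for b w
    unfolding frechet_derivative_eqI[OF dF] by (simp add: skew)
  have "(\<Sum>b\<in>Basis. frechet_derivative (F b) (at w) b) = bump w *\<^sub>R frechet_derivative k (at w) (J w)" for w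
  proof -
    have "(\<Sum>b\<in>Basis. frechet_derivative (F b) (at w) b) =
       bump w *\<^sub>R frechet_derivative k (at w) (J w) + frechet_derivative bump (at w) (J w) *\<^sub>R k w"
      unfolding D C1_derivative_Basis[OF k, of w "J w"] C1_derivative_Basis[OF C1_bump, of w "J w"]
      by (simp add: scaleR_add_right sum.distrib scaleR_sum_right scaleR_sum_left mult_ac)
    moreover have "w \<bullet> J w = 0" using skew[of w] by (simp add: inner_commute)
    ultimately show ?thesis by (simp add: frechet_derivative_bump)
  qed
  then have "(LINT w|lborel. bump w *\<^sub>R frechet_derivative k (at w) (J w)) =
     (LINT w|lborel. (\<Sum>b\<in>Basis. frechet_derivative (F b) (at w) b))" by simp
  also have "\<dots> = (\<Sum>b\<in>Basis. LINT w|lborel. frechet_derivative (F b) (at w) b)"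
    by (intro Bochner_Integration.integral_sum integral_derivative_eq_0(1)[OF C, where r=1])
       (simp add: F_def bump_eq_0)
  also have "\<dots> = 0"
    by (intro sum.neutral ballI integral_derivative_eq_0(2)[OF C, where r=1])
       (simp add: F_def bump_eq_0)
  finally show ?thesis .
qed

section \<open>Mean value property of entire functions\<close>

lemma bump_eq_0_outside_cbox: "w \<notin> cbox (- One) One \<Longrightarrow> bump w = 0"
  using norm_gt_of_notin_cbox[of w 1] bump_eq_0[of w] by simp

text \<open>
  The radial derivative of an entire function is \<open>- \<i>\<close> times its derivative along \<open>\<i> *s w\<close>, so the
  mean over the bump of \<open>h (s *\<^sub>R w)\<close> does not depend on \<open>s\<close>.
\<close>

lemma entire_bump_mean:
  fixes h :: "('n::finite) cfun"
  assumes h: "entire h"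
  shows "(LINT w|lborel. bump w *\<^sub>R h w) = (LINT w|lborel. bump (w::complex^'n)) *\<^sub>R h 0"
proof -
  define l u :: "complex^'n" where "l = - One" and "u = One"
  define I where "I s = integral (cbox l u) (\<lambda>w. bump w *\<^sub>R h (s *\<^sub>R w))" for s :: real
  have ch: "continuous_on S (\<lambda>x. h (p x))" if "continuous_on S p" for S and p :: "'b::topological_space \<Rightarrow> _"
    by (rule continuous_on_compose2[OF entire_continuous[OF h] that]) auto
  have cb: "continuous_on S (\<lambda>x. bump (p x))" if "continuous_on S p" for S and p :: "'b::topological_space \<Rightarrow> complex^'n"
    by (rule continuous_on_compose2[OF C1_continuous[OF C1_bump] that]) auto
  have I_lint: "I s = (LINT w|lborel. bump w *\<^sub>R h (s *\<^sub>R w))" for s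
    unfolding I_def
    by (rule continuous_compact_support_integrable(2)[symmetric])
       (auto intro!: continuous_intros ch cb bump_eq_0_outside_cbox simp: l_def u_def)
  let ?fx = "\<lambda>s w. bump w *\<^sub>R frechet_derivative h (at (s *\<^sub>R w)) w"
  \<comment> \<open>The argument divides by \<open>s\<close>, so it omits \<open>s = 0\<close>; this
    one point becomes the exceptional set \<open>{0}\<close> when \<open>I\<close> is shown to be
    constant on the unit interval.\<close>
  have fx0: "integral (cbox l u) (?fx s) = 0" if "s \<noteq> 0" for s
  proof -
    define k where "k w = h (s *\<^sub>R w)" for w
    note k = C1_scaleR_argument[OF entire_C1[OF h], of s, folded k_def]
    have "integral (cbox l u) (?fx s) = (LINT w|lborel. ?fx s w)"
      by (rule continuous_compact_support_integrable(2)[symmetric])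
         (auto intro!: continuous_intros C1_continuous_derivative_joint entire_C1 h cb bump_eq_0_outside_cbox simp: l_def u_def)
    also have "\<dots> = (LINT w|lborel. (- \<i> / s) * (bump w *\<^sub>R frechet_derivative k (at w) (\<i> *s w)))"
    proof (intro Bochner_Integration.integral_cong refl)
      fix w
      \<comment> \<open>The chain rule for \<open>k\<close> produces the factor \<open>s\<close> and
        the rotation produces the factor i; the constant \<open>- \<i> / s\<close> undoes
        both.\<close>
      have "x = (- \<i> / s) * (s *\<^sub>R (\<i> * x))" for x
        using that by (simp add: scaleR_conv_of_real)
      then show "?fx s w = (- \<i> / s) * (bump w *\<^sub>R frechet_derivative k (at w) (\<i> *s w))"
        unfolding k entire_derivative_complex_linear[OF h] mult_scaleR_right by metis
    qed
    also have "\<dots> = (- \<i> / s) * (LINT w|lborel. bump w *\<^sub>R frechet_derivative k (at w) (\<i> *s w))"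
      by (rule integral_mult_right_zero)
    also have "\<dots> = 0"
      by (subst integral_bump_skew_derivative[OF k(1)])
         (auto simp: inner_ii_mult intro: bounded_linear.linear bounded_linear_complex_scalar_mult)
    finally show ?thesis .
  qed
  have d: "(I has_vector_derivative integral (cbox l u) (?fx s)) (at s within UNIV)" for s
    unfolding I_def
  proof (rule leibniz_rule_vector_derivative[where fx="?fx"])
    fix s :: real and w
    have "((\<lambda>s. h (s *\<^sub>R w)) has_derivative (\<lambda>t. frechet_derivative h (at (s *\<^sub>R w)) (t *\<^sub>R w))) (at s)"
      by (rule has_derivative_compose[OF _ entire_has_derivative[OF h]])
         (auto intro!: derivative_eq_intros)
    then have "((\<lambda>s. h (s *\<^sub>R w)) has_vector_derivative frechet_derivative h (at (s *\<^sub>R w)) w) (at s)"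
      unfolding has_vector_derivative_def linear_scale[OF C1_linear[OF entire_C1[OF h]]] .
    then show "((\<lambda>s. bump w *\<^sub>R h (s *\<^sub>R w)) has_vector_derivative ?fx s w) (at s within UNIV)"
      using bounded_linear.has_vector_derivative[OF bounded_linear_scaleR_right] by blast
  next
    show "(\<lambda>w. bump w *\<^sub>R h (s *\<^sub>R w)) integrable_on cbox l u" for s
      by (intro integrable_continuous continuous_intros ch cb)
    show "continuous_on (UNIV \<times> cbox l u) (\<lambda>(s, w). ?fx s w)"
      unfolding split_beta by (intro continuous_intros C1_continuous_derivative_joint entire_C1 h cb)
  qed auto
  have "I 1 = I 0"
  proof (rule has_derivative_zero_unique_strong_interval[of "{0}" 0 1 I "I 0" 1])
    show "continuous_on {0..1} I"
      using d by (auto intro!: continuous_at_imp_continuous_on has_vector_derivative_continuous)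
    show "(I has_derivative (\<lambda>h. 0)) (at x within {0..1})" if "x \<in> {0..1} - {0}" for x
      using d[of x] fx0[of x] that
      by (auto simp: has_vector_derivative_def intro: has_derivative_at_withinI)
  qed auto
  then show ?thesis
    by (simp add: I_lint bump_integrable)
qed

lemma entire_bump_mean_at:
  fixes h :: "('n::finite) cfun"
  assumes h: "entire h"
  shows "(LINT w|lborel. bump (w - z) *\<^sub>R h w) = (LINT w|lborel. bump (w::complex^'n)) *\<^sub>R h z"
proof -
  have [measurable]: "h \<in> borel_measurable borel" "bump \<in> borel_measurable (borel :: (complex^'n) measure)"
    using C1_continuous[OF C1_bump] entire_continuous[OF h]
    by (auto intro: borel_measurable_continuous_onI)
  have "(LINT w|lborel. bump (w - z) *\<^sub>R h w) = (LINT w|lborel. bump (w + z - z) *\<^sub>R h (w + z))"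
    by (rule integral_translate[symmetric]) measurable
  also have "\<dots> = (LINT w|lborel. bump w *\<^sub>R h (z + w))" by (simp add: add.commute)
  also have "\<dots> = (LINT w|lborel. bump (w::complex^'n)) *\<^sub>R h z"
    using entire_bump_mean[OF entire_translate[OF h], of z] by simp
  finally show ?thesis .
qed


section \<open>Weighted spaces and the Bergman projection\<close>

text \<open>Gives integrability of the limit together with the bound. It serves twice: for the
  minimizing sequence of the projection and for the cut-off Levi integrals.\<close>

lemma integrable_fatou:
  fixes f :: "'a \<Rightarrow> real"
  assumes f: "\<And>n. integrable M (s n)" "\<And>n x. 0 \<le> s n x" "\<And>x. (\<lambda>n. s n x) \<longlonglongrightarrow> f x"
    and le: "\<And>n. (LINT x|M. s n x) \<le> c n" "c \<longlonglongrightarrow> l"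
  shows "integrable M f" "(LINT x|M. f x) \<le> l"
proof -
  have [measurable]: "s n \<in> borel_measurable M" for n using f(1) by auto
  have [measurable]: "f \<in> borel_measurable M"
    by (rule borel_measurable_LIMSEQ_real[OF f(3)]) auto
  have f0: "0 \<le> f x" for x
    by (rule LIMSEQ_le_const[OF f(3)]) (use f(2) in auto)
  have c0: "0 \<le> c n" for n
    using le(1)[of n] integral_nonneg_AE[of "s n" M] f(2) by (smt (verit) AE_I2)
  have l0: "0 \<le> l" by (rule LIMSEQ_le_const[OF le(2)]) (use c0 in auto)
  have "(\<integral>\<^sup>+x. ennreal (f x) \<partial>M) = (\<integral>\<^sup>+x. liminf (\<lambda>n. ennreal (s n x)) \<partial>M)"
    by (intro nn_integral_cong lim_imp_Liminf[symmetric] tendsto_ennrealI f) simp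
  also have "\<dots> \<le> liminf (\<lambda>n. \<integral>\<^sup>+x. ennreal (s n x) \<partial>M)"
    by (rule nn_integral_liminf) simp
  also have "\<dots> = liminf (\<lambda>n. ennreal (LINT x|M. s n x))"
    using f by (simp add: nn_integral_eq_integral)
  also have "\<dots> \<le> liminf (\<lambda>n. ennreal (c n))"
    by (intro Liminf_mono always_eventually allI ennreal_leI le)
  also have "\<dots> = ennreal l"
    by (intro lim_imp_Liminf tendsto_ennrealI le) simp
  finally have *: "(\<integral>\<^sup>+x. ennreal (f x) \<partial>M) \<le> ennreal l" .
  show i: "integrable M f"
    by (rule integrableI_bounded) (use * f0 in \<open>auto simp: ennreal_less_top order_le_less_trans\<close>)
  show "(LINT x|M. f x) \<le> l"
    using * f0 l0 i by (simp add: nn_integral_eq_integral)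
qed

lemma borel_measurable_cnj [measurable]: "cnj \<in> borel_measurable borel"
  by (intro borel_measurable_continuous_onI continuous_intros)

lemma cmod_mult_le_sum_power2: "cmod (a * b) \<le> (cmod a)\<^sup>2 + (cmod b)\<^sup>2"
proof -
  have "2 * (cmod a * cmod b) \<le> (cmod a)\<^sup>2 + (cmod b)\<^sup>2"
    using sum_squares_bound[of "cmod a" "cmod b"] by simp
  moreover have "0 \<le> cmod a * cmod b" by simp
  ultimately show ?thesis unfolding norm_mult by linarith
qed

locale continuous_weight =
  fixes \<phi> :: "complex^'n::finite \<Rightarrow> real"
  assumes continuous: "continuous_on UNIV \<phi>"
begin

lemma measurable_weight [measurable]: "\<phi> \<in> borel_measurable borel"
  by (rule borel_measurable_continuous_onI[OF continuous])

lemma L2_measurable: "f \<in> L2 \<phi> \<Longrightarrow> f \<in> borel_measurable borel"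
  by (simp add: L2_def)

lemma L2_integrable: "f \<in> L2 \<phi> \<Longrightarrow> integrable lborel (\<lambda>z. (cmod (f z))\<^sup>2 * exp (- \<phi> z))"
  by (simp add: L2_def)

lemma L2_ip_exists:
  assumes "f \<in> L2 \<phi>" "g \<in> L2 \<phi>"
  shows "ip_exists \<phi> f g"
  unfolding ip_exists_def
proof (rule Bochner_Integration.integrable_bound)
  note [measurable] = assms[THEN L2_measurable]
  show "integrable lborel (\<lambda>z. (cmod (f z))\<^sup>2 * exp (- \<phi> z) + (cmod (g z))\<^sup>2 * exp (- \<phi> z))"
    using assms by (intro Bochner_Integration.integrable_add L2_integrable)
  show "(\<lambda>z. f z * cnj (g z) * complex_of_real (exp (- \<phi> z))) \<in> borel_measurable lborel"
    by measurable
  show "AE z in lborel. norm (f z * cnj (g z) * complex_of_real (exp (- \<phi> z)))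
     \<le> norm ((cmod (f z))\<^sup>2 * exp (- \<phi> z) + (cmod (g z))\<^sup>2 * exp (- \<phi> z))"
  proof (intro AE_I2)
    fix z
    have "cmod (f z * cnj (g z)) * exp (- \<phi> z) \<le> ((cmod (f z))\<^sup>2 + (cmod (g z))\<^sup>2) * exp (- \<phi> z)"
      using cmod_mult_le_sum_power2[of "f z" "cnj (g z)"] by (intro mult_right_mono) auto
    then show "norm (f z * cnj (g z) * complex_of_real (exp (- \<phi> z)))
     \<le> norm ((cmod (f z))\<^sup>2 * exp (- \<phi> z) + (cmod (g z))\<^sup>2 * exp (- \<phi> z))"
      by (simp add: norm_mult distrib_right)
  qed
qed

lemma L2_add_scaled:
  assumes "f \<in> L2 \<phi>" "g \<in> L2 \<phi>"
  shows "(\<lambda>z. f z + c * g z) \<in> L2 \<phi>"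
proof -
  note [measurable] = assms[THEN L2_measurable]
  have "integrable lborel (\<lambda>z. (cmod (f z + c * g z))\<^sup>2 * exp (- \<phi> z))"
  proof (rule Bochner_Integration.integrable_bound)
    show "integrable lborel (\<lambda>z. 2 * ((cmod (f z))\<^sup>2 * exp (- \<phi> z)) + 2 * (cmod c)\<^sup>2 * ((cmod (g z))\<^sup>2 * exp (- \<phi> z)))"
      using assms by (intro Bochner_Integration.integrable_add integrable_mult_right L2_integrable)
    show "AE z in lborel. norm ((cmod (f z + c * g z))\<^sup>2 * exp (- \<phi> z))
      \<le> norm (2 * ((cmod (f z))\<^sup>2 * exp (- \<phi> z)) + 2 * (cmod c)\<^sup>2 * ((cmod (g z))\<^sup>2 * exp (- \<phi> z)))"
    proof (intro AE_I2)
      fix z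
      have "(cmod (f z + c * g z))\<^sup>2 \<le> (cmod (f z) + cmod (c * g z))\<^sup>2"
        by (intro power_mono norm_triangle_ineq) simp
      also have "\<dots> \<le> 2 * (cmod (f z))\<^sup>2 + 2 * (cmod (c * g z))\<^sup>2"
        using sum_squares_bound[of "cmod (f z)" "cmod (c * g z)"] by (simp add: power2_sum)
      finally have "(cmod (f z + c * g z))\<^sup>2 * exp (- \<phi> z) \<le> (2 * (cmod (f z))\<^sup>2 + 2 * (cmod (c * g z))\<^sup>2) * exp (- \<phi> z)"
        by (intro mult_right_mono) auto
      then show "norm ((cmod (f z + c * g z))\<^sup>2 * exp (- \<phi> z))
        \<le> norm (2 * ((cmod (f z))\<^sup>2 * exp (- \<phi> z)) + 2 * (cmod c)\<^sup>2 * ((cmod (g z))\<^sup>2 * exp (- \<phi> z)))"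
        by (simp add: norm_mult power_mult_distrib algebra_simps)
    qed
  qed measurable
  then show ?thesis by (simp add: L2_def)
qed

lemma L2_0: "(\<lambda>z. 0) \<in> L2 \<phi>" by (simp add: L2_def)

lemma L2_diff: "f \<in> L2 \<phi> \<Longrightarrow> g \<in> L2 \<phi> \<Longrightarrow> (\<lambda>z. f z - g z) \<in> L2 \<phi>"
  using L2_add_scaled[of f g "-1"] by simp

lemma L2_sum: "(\<And>i. i \<in> I \<Longrightarrow> f i \<in> L2 \<phi>) \<Longrightarrow> (\<lambda>z. \<Sum>i\<in>I. f i z) \<in> L2 \<phi>"
proof (induction I rule: infinite_finite_induct)
  case (insert i I)
  then show ?case using L2_add_scaled[of "f i" "\<lambda>z. \<Sum>i\<in>I. f i z" 1] by simp
qed (auto simp: L2_0)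

lemma A2_L2: "f \<in> A2 \<phi> \<Longrightarrow> f \<in> L2 \<phi>" and A2_entire: "f \<in> A2 \<phi> \<Longrightarrow> entire f"
  by (auto simp: A2_def)

lemma A2_add_scaled: "f \<in> A2 \<phi> \<Longrightarrow> g \<in> A2 \<phi> \<Longrightarrow> (\<lambda>z. f z + c * g z) \<in> A2 \<phi>"
  by (auto simp: A2_def L2_add_scaled entire_add_scaled)

lemma A2_diff: "f \<in> A2 \<phi> \<Longrightarrow> g \<in> A2 \<phi> \<Longrightarrow> (\<lambda>z. f z - g z) \<in> A2 \<phi>"
  using A2_add_scaled[of f g "-1"] by simp

lemma A2_0: "(\<lambda>z. 0) \<in> A2 \<phi>" by (simp add: A2_def L2_0 entire_0)

lemma A2_sum: "(\<And>i. i \<in> I \<Longrightarrow> f i \<in> A2 \<phi>) \<Longrightarrow> (\<lambda>z. \<Sum>i\<in>I. f i z) \<in> A2 \<phi>"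
proof (induction I rule: infinite_finite_induct)
  case (insert i I)
  then show ?case using A2_add_scaled[of "f i" "\<lambda>z. \<Sum>i\<in>I. f i z" 1] by simp
qed (auto simp: A2_0)

section \<open>Inner product and norm identities\<close>

lemma ip_commute: "ip \<phi> f g = cnj (ip \<phi> g f)"
  unfolding ip_def by (subst Bochner_Integration.integral_cnj[symmetric]) (simp add: mult_ac)

lemma ip_add_scaled_left:
  assumes "f \<in> L2 \<phi>" "g \<in> L2 \<phi>" "h \<in> L2 \<phi>"
  shows "ip \<phi> (\<lambda>z. f z + c * g z) h = ip \<phi> f h + c * ip \<phi> g h"
proof -
  have "ip \<phi> (\<lambda>z. f z + c * g z) h = (LINT z|lborel. f z * cnj (h z) * complex_of_real (exp (- \<phi> z))
     + c * (g z * cnj (h z) * complex_of_real (exp (- \<phi> z))))"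
    unfolding ip_def by (intro Bochner_Integration.integral_cong) (auto simp: algebra_simps)
  also have "\<dots> = ip \<phi> f h + c * ip \<phi> g h"
    using L2_ip_exists[OF assms(1,3)] L2_ip_exists[OF assms(2,3)]
    unfolding ip_def ip_exists_def by simp
  finally show ?thesis .
qed

lemma ip_diff_left:
  assumes "f \<in> L2 \<phi>" "g \<in> L2 \<phi>" "h \<in> L2 \<phi>"
  shows "ip \<phi> (\<lambda>z. f z - g z) h = ip \<phi> f h - ip \<phi> g h"
  using ip_add_scaled_left[OF assms, of "-1"] by simp

lemma ip_diff_right:
  assumes "f \<in> L2 \<phi>" "g \<in> L2 \<phi>" "h \<in> L2 \<phi>"
  shows "ip \<phi> h (\<lambda>z. f z - g z) = ip \<phi> h f - ip \<phi> h g"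
  unfolding ip_commute[of h] ip_diff_left[OF assms] by (rule complex_cnj_diff)

lemma ip_sum_left:
  assumes "\<And>i. i \<in> I \<Longrightarrow> f i \<in> L2 \<phi>" "h \<in> L2 \<phi>"
  shows "ip \<phi> (\<lambda>z. \<Sum>i\<in>I. f i z) h = (\<Sum>i\<in>I. ip \<phi> (f i) h)"
  using assms(1)
proof (induction I rule: infinite_finite_induct)
  case (insert i I)
  then show ?case
    using ip_add_scaled_left[of "f i" "\<lambda>z. \<Sum>i\<in>I. f i z" h 1] assms(2) by (simp add: L2_sum)
qed (auto simp: ip_def)

lemma ip_sum_right:
  assumes "\<And>i. i \<in> I \<Longrightarrow> f i \<in> L2 \<phi>" "h \<in> L2 \<phi>"
  shows "ip \<phi> h (\<lambda>z. \<Sum>i\<in>I. f i z) = (\<Sum>i\<in>I. ip \<phi> h (f i))"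
proof -
  have "ip \<phi> h (\<lambda>z. \<Sum>i\<in>I. f i z) = cnj (ip \<phi> (\<lambda>z. \<Sum>i\<in>I. f i z) h)"
    by (rule ip_commute)
  also have "\<dots> = (\<Sum>i\<in>I. cnj (ip \<phi> (f i) h))"
    by (simp add: ip_sum_left[OF assms])
  finally show ?thesis unfolding ip_commute[of h] .
qed

lemma nrm_power2: "(nrm \<phi> f)\<^sup>2 = (LINT z|lborel. (cmod (f z))\<^sup>2 * exp (- \<phi> z))"
  unfolding nrm_def by (intro real_sqrt_pow2 integral_nonneg_AE AE_I2) auto

lemma ip_self: "ip \<phi> f f = complex_of_real ((nrm \<phi> f)\<^sup>2)"
proof -
  have "ip \<phi> f f = (LINT z|lborel. complex_of_real ((cmod (f z))\<^sup>2 * exp (- \<phi> z)))"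
    unfolding ip_def by (intro Bochner_Integration.integral_cong)
      (simp_all add: complex_norm_square del: of_real_power)
  then show ?thesis by (simp add: nrm_power2 integral_complex_of_real del: of_real_mult)
qed

text \<open>A single expansion gives the parallelogram law (\<open>c = 1\<close> and
  \<open>c = -1\<close>), the variational argument for orthogonality (small \<open>c\<close>) and
  the theorem of Pythagoras.\<close>

lemma nrm_add_scaled_power2:
  assumes "f \<in> L2 \<phi>" "g \<in> L2 \<phi>"
  shows "(nrm \<phi> (\<lambda>z. f z + c * g z))\<^sup>2 =
    (nrm \<phi> f)\<^sup>2 + 2 * Re (cnj c * ip \<phi> f g) + (cmod c)\<^sup>2 * (nrm \<phi> g)\<^sup>2"
proof -
  let ?s = "\<lambda>z. f z + c * g z"
  have s: "?s \<in> L2 \<phi>" using assms by (rule L2_add_scaled)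
  have "ip \<phi> ?s ?s = ip \<phi> f ?s + c * ip \<phi> g ?s"
    by (rule ip_add_scaled_left) (use assms s in auto)
  also have "ip \<phi> f ?s = cnj (ip \<phi> f f + c * ip \<phi> g f)"
    unfolding ip_commute[of f ?s] by (subst ip_add_scaled_left) (use assms in auto)
  also have "ip \<phi> g ?s = cnj (ip \<phi> f g + c * ip \<phi> g g)"
    unfolding ip_commute[of g ?s] by (subst ip_add_scaled_left) (use assms in auto)
  finally have "complex_of_real ((nrm \<phi> ?s)\<^sup>2) =
     complex_of_real ((nrm \<phi> f)\<^sup>2) + (cnj c * ip \<phi> f g + cnj (cnj c * ip \<phi> f g)) + c * cnj c * complex_of_real ((nrm \<phi> g)\<^sup>2)"
    unfolding ip_self ip_commute[of g f] by (simp add: algebra_simps)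
  also have "\<dots> = complex_of_real ((nrm \<phi> f)\<^sup>2 + 2 * Re (cnj c * ip \<phi> f g) + (cmod c)\<^sup>2 * (nrm \<phi> g)\<^sup>2)"
    unfolding complex_add_cnj complex_norm_square[symmetric] by simp
  finally show ?thesis by (simp only: of_real_eq_iff)
qed

lemma nrm_parallelogram:
  assumes "f \<in> L2 \<phi>" "g \<in> L2 \<phi>"
  shows "(nrm \<phi> (\<lambda>z. f z - g z))\<^sup>2 = 2 * (nrm \<phi> f)\<^sup>2 + 2 * (nrm \<phi> g)\<^sup>2 - (nrm \<phi> (\<lambda>z. f z + g z))\<^sup>2"
  using nrm_add_scaled_power2[OF assms, of 1] nrm_add_scaled_power2[OF assms, of "-1"] by simp

lemma nrm_scaled_power2: "(nrm \<phi> (\<lambda>z. c * f z))\<^sup>2 = (cmod c)\<^sup>2 * (nrm \<phi> f)\<^sup>2"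
  by (simp add: nrm_power2 norm_mult power_mult_distrib mult.assoc)

text \<open>The mean value property is applied to \<open>h\<^sup>2\<close>, which avoids the Cauchy--Schwarz inequality.\<close>

lemma A2_evaluation_bound:
  obtains C where "0 \<le> C" "\<And>h z. h \<in> A2 \<phi> \<Longrightarrow> norm z \<le> R \<Longrightarrow> cmod (h z) \<le> C * nrm \<phi> h"
proof -
  define b where "b = (LINT w|lborel. bump (w::complex^'n))"
  have b: "0 < b" unfolding b_def by (rule bump_integral_pos)
  \<comment> \<open>The bump centred at \<open>z\<close> lives in the ball of radius
    \<open>R + 1\<close>. An upper bound \<open>M\<close> for \<open>\<phi>\<close> there bounds the
    weight below by \<open>exp (- M)\<close>, which the factor \<open>exp M\<close>
    compensates.\<close>
  have "compact (\<phi> ` cball 0 (R + 1))"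
    by (intro compact_continuous_image continuous_on_subset[OF continuous]) auto
  then obtain M where M: "\<And>z. norm z \<le> R + 1 \<Longrightarrow> \<phi> z \<le> M"
    using bounded_imp_bdd_above[OF compact_imp_bounded] unfolding bdd_above_def by force
  have main: "cmod (h z) \<le> sqrt (exp M / b) * nrm \<phi> h" if h: "h \<in> A2 \<phi>" and z: "norm z \<le> R" for h z
  proof -
    let ?g = "\<lambda>z. h z * h z"
    have eg: "entire ?g" by (intro entire_mult A2_entire h)
    have "b * cmod (?g z) = norm (LINT w|lborel. bump (w - z) *\<^sub>R ?g w)"
      using b unfolding entire_bump_mean_at[OF eg] b_def[symmetric] by simp
    also have "\<dots> \<le> (LINT w|lborel. exp M * ((cmod (h w))\<^sup>2 * exp (- \<phi> w)))"
    proof (rule Bochner_Integration.integral_norm_bound_integral)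
      have 0: "bump (w - z) = 0" if "w \<notin> cbox (z - One) (z + One)" for w
        using that by (intro bump_eq_0_outside_cbox) (auto simp: mem_box algebra_simps)
      show "integrable lborel (\<lambda>w. bump (w - z) *\<^sub>R ?g w)"
        by (rule continuous_compact_support_integrable(1)[where a="z - One" and b="z + One"])
           (auto intro!: continuous_intros entire_continuous[OF A2_entire[OF h]]
             continuous_on_compose2[OF C1_continuous[OF C1_bump]] simp: 0)
      show "integrable lborel (\<lambda>w. exp M * ((cmod (h w))\<^sup>2 * exp (- \<phi> w)))"
        by (intro integrable_mult_right L2_integrable A2_L2 h)
      show "norm (bump (w - z) *\<^sub>R ?g w) \<le> exp M * ((cmod (h w))\<^sup>2 * exp (- \<phi> w))" for w
      proof (cases "1 \<le> norm (w - z)")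
        case True
        then show ?thesis by (simp add: bump_eq_0)
      next
        case False
        then have "norm w \<le> R + 1" using z norm_triangle_ineq[of z "w - z"] by simp
        then have "1 \<le> exp M * exp (- \<phi> w)" using M[of w] by (simp flip: exp_add)
        then have "(cmod (h w))\<^sup>2 * 1 \<le> (cmod (h w))\<^sup>2 * (exp M * exp (- \<phi> w))"
          by (intro mult_left_mono) auto
        moreover have "bump (w - z) * (cmod (h w))\<^sup>2 \<le> 1 * (cmod (h w))\<^sup>2"
          by (intro mult_right_mono bump_le_1) simp
        ultimately show ?thesis
          by (simp add: norm_mult bump_nonneg power2_eq_square mult_ac)
      qed
    qed
    also have "\<dots> = exp M * (nrm \<phi> h)\<^sup>2" by (simp add: nrm_power2)
    finally have "(cmod (h z))\<^sup>2 \<le> exp M / b * (nrm \<phi> h)\<^sup>2"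
      using b by (simp add: norm_mult power2_eq_square field_simps)
    then have "cmod (h z) \<le> sqrt (exp M / b * (nrm \<phi> h)\<^sup>2)" by (rule real_le_rsqrt)
    moreover have "0 \<le> nrm \<phi> h" by (simp add: nrm_def)
    ultimately show ?thesis unfolding real_sqrt_mult[of "exp M / b"] by simp
  qed
  have "0 \<le> sqrt (exp M / b)" using b by simp
  with main show ?thesis by (rule that[rotated])
qed

text \<open>Cauchy's bound on the unit circle in the normalized direction combines with evaluation
  on the ball of radius \<open>R + 1\<close>. The factor \<open>norm w\<close> makes this an
  operator bound, as uniform convergence of derivatives requires.\<close>

lemma A2_derivative_bound:
  obtains C where "0 \<le> C" "\<And>h z w. h \<in> A2 \<phi> \<Longrightarrow> norm z \<le> R \<Longrightarrow>
    cmod (frechet_derivative h (at z) w) \<le> C * nrm \<phi> h * norm w"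
proof -
  obtain C where C: "0 \<le> C" "\<And>h z. h \<in> A2 \<phi> \<Longrightarrow> norm z \<le> R + 1 \<Longrightarrow> cmod (h z) \<le> C * nrm \<phi> h"
    using A2_evaluation_bound by blast
  have "cmod (frechet_derivative h (at z) w) \<le> C * nrm \<phi> h * norm w"
    if h: "h \<in> A2 \<phi>" and z: "norm z \<le> R" for h z w
  proof (cases "w = 0")
    case True
    then show ?thesis
      using linear_0[OF C1_linear[OF entire_C1[OF A2_entire[OF h]]]] by simp
  next
    case False
    define e where "e = (1 / norm w) *\<^sub>R w"
    have e: "norm e = 1" "w = norm w *\<^sub>R e" using False by (auto simp: e_def)
    have "cmod (frechet_derivative h (at z) e) \<le> C * nrm \<phi> h"
    proof (rule entire_derivative_bound[OF A2_entire[OF h]])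
      fix \<zeta> :: complex assume "cmod \<zeta> = 1"
      then have "norm (z + \<zeta> *s e) \<le> R + 1"
        using norm_triangle_ineq[of z "\<zeta> *s e"] z by (simp add: norm_complex_scalar_mult e)
      then show "cmod (h (z + \<zeta> *s e)) \<le> C * nrm \<phi> h" by (rule C(2)[OF h])
    qed
    then have "norm w * cmod (frechet_derivative h (at z) e) \<le> norm w * (C * nrm \<phi> h)"
      by (intro mult_left_mono) auto
    moreover have "frechet_derivative h (at z) w = norm w *\<^sub>R frechet_derivative h (at z) e"
      by (subst e(2)) (rule linear_scale[OF C1_linear[OF entire_C1[OF A2_entire[OF h]]]])
    ultimately show ?thesis by (simp add: mult_ac)
  qed
  with C(1) show ?thesis using that by blast
qed

text \<open>The bounds applied to \<open>h m - h n\<close> make the derivatives converge uniformly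
  on balls, so the pointwise limit is differentiable with derivative \<open>G\<close>, and
  \<open>G\<close> is complex linear as a limit of complex linear maps. Square integrability of the
  limit is left to Fatou's lemma in \<open>A2_nearest\<close>.\<close>

lemma A2_Cauchy_limit:
  assumes h: "\<And>n. h n \<in> A2 \<phi>"
    and Cau: "\<And>e. 0 < e \<Longrightarrow> \<exists>N. \<forall>m\<ge>N. \<forall>n\<ge>N. nrm \<phi> (\<lambda>z. h m z - h n z) < e"
  obtains g where "entire g" "\<And>z. (\<lambda>n. h n z) \<longlonglongrightarrow> g z"
proof -
  have D: "((h n) has_derivative frechet_derivative (h n) (at z)) (at z)" for n z
    by (rule entire_has_derivative[OF A2_entire[OF h]])
  have Ddiff: "frechet_derivative (\<lambda>z. h m z - h n z) (at z) w =
     frechet_derivative (h m) (at z) w - frechet_derivative (h n) (at z) w" for m n z w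
    by (rule frechet_derivative_eqI[OF has_derivative_diff[OF D D]])
  have small: "\<exists>N. \<forall>m\<ge>N. \<forall>n\<ge>N. C * nrm \<phi> (\<lambda>z. h m z - h n z) \<le> e" if "0 \<le> C" "0 < e" for C e :: real
  proof -
    \<comment> \<open>\<open>C\<close> may be 0, hence the denominator \<open>C + 1\<close>.\<close>
    have "0 < e / (C + 1)" using that by simp
    then obtain N where N: "\<forall>m\<ge>N. \<forall>n\<ge>N. nrm \<phi> (\<lambda>z. h m z - h n z) < e / (C + 1)"
      using Cau by blast
    have "C * nrm \<phi> (\<lambda>z. h m z - h n z) \<le> e" if "m \<ge> N" "n \<ge> N" for m n
    proof -
      have "(C + 1) * nrm \<phi> (\<lambda>z. h m z - h n z) < e"
      proof -
        have "nrm \<phi> (\<lambda>z. h m z - h n z) < e / (C + 1)" using N that by blast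
        moreover have "0 < C + 1" using \<open>0 \<le> C\<close> by simp
        ultimately show ?thesis by (simp only: pos_less_divide_eq mult.commute)
      qed
      moreover have "0 \<le> nrm \<phi> (\<lambda>z. h m z - h n z)" by (simp add: nrm_def)
      ultimately show ?thesis by (simp add: distrib_right)
    qed
    then show ?thesis by blast
  qed
  have Dunif: "\<exists>N. \<forall>m\<ge>N. \<forall>n\<ge>N. \<forall>z\<in>ball 0 R. \<forall>w.
      cmod (frechet_derivative (h m) (at z) w - frechet_derivative (h n) (at z) w) \<le> e * norm w"
    if e: "0 < e" for R e
  proof -
    obtain C where C: "0 \<le> C" "\<And>h z w. h \<in> A2 \<phi> \<Longrightarrow> norm z \<le> R \<Longrightarrow>
        cmod (frechet_derivative h (at z) w) \<le> C * nrm \<phi> h * norm w"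
      using A2_derivative_bound by blast
    obtain N where N: "\<And>m n. m \<ge> N \<Longrightarrow> n \<ge> N \<Longrightarrow> C * nrm \<phi> (\<lambda>z. h m z - h n z) \<le> e"
      using small[OF C(1) e] by blast
    have "cmod (frechet_derivative (h m) (at z) w - frechet_derivative (h n) (at z) w) \<le> e * norm w"
      if "m \<ge> N" "n \<ge> N" "z \<in> ball 0 R" for m n z w
    proof -
      have "cmod (frechet_derivative (\<lambda>z. h m z - h n z) (at z) w) \<le> C * nrm \<phi> (\<lambda>z. h m z - h n z) * norm w"
        by (rule C(2)[OF A2_diff[OF h h]]) (use that in simp)
      also have "\<dots> \<le> e * norm w" by (intro mult_right_mono N that) simp
      finally show ?thesis by (simp add: Ddiff)
    qed
    then show ?thesis by blast
  qed
  have Dconv: "convergent (\<lambda>n. frechet_derivative (h n) (at z) w)" for z w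
  proof (rule Cauchy_convergent, rule metric_CauchyI)
    fix e :: real assume "0 < e"
    define e' where "e' = e / (norm w + 1)"
    have "e' * norm w < e" "0 < e'" using \<open>0 < e\<close> by (auto simp: e'_def field_simps add_pos_nonneg)
    from Dunif[OF \<open>0 < e'\<close>, of "norm z + 1"]
    obtain N where "\<forall>m\<ge>N. \<forall>n\<ge>N. \<forall>z\<in>ball 0 (norm z + 1). \<forall>w.
      cmod (frechet_derivative (h m) (at z) w - frechet_derivative (h n) (at z) w) \<le> e' * norm w" by blast
    then have "\<forall>m\<ge>N. \<forall>n\<ge>N. cmod (frechet_derivative (h m) (at z) w - frechet_derivative (h n) (at z) w) \<le> e' * norm w"
      by (metis less_add_one mem_ball_0)
    then show "\<exists>N. \<forall>m\<ge>N. \<forall>n\<ge>N. dist (frechet_derivative (h m) (at z) w) (frechet_derivative (h n) (at z) w) < e"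
      using \<open>e' * norm w < e\<close> unfolding dist_norm by (meson le_less_trans)
  qed
  define G where "G z w = lim (\<lambda>n. frechet_derivative (h n) (at z) w)" for z w
  have G: "(\<lambda>n. frechet_derivative (h n) (at z) w) \<longlonglongrightarrow> G z w" for z w
    using Dconv unfolding G_def convergent_LIMSEQ_iff .
  have Gc: "G z (c *s w) = c * G z w" for z c w
  proof (rule LIMSEQ_unique[OF G])
    show "(\<lambda>n. frechet_derivative (h n) (at z) (c *s w)) \<longlonglongrightarrow> c * G z w"
      unfolding entire_derivative_complex_linear[OF A2_entire[OF h]] by (intro tendsto_intros G)
  qed
  obtain C0 where C0: "0 \<le> C0" "\<And>h z. h \<in> A2 \<phi> \<Longrightarrow> norm z \<le> 0 \<Longrightarrow> cmod (h z) \<le> C0 * nrm \<phi> h"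
    using A2_evaluation_bound by blast
  have "Cauchy (\<lambda>n. h n 0)"
  proof (rule metric_CauchyI)
    fix e :: real assume "0 < e"
    then obtain N where N: "\<And>m n. m \<ge> N \<Longrightarrow> n \<ge> N \<Longrightarrow> C0 * nrm \<phi> (\<lambda>z. h m z - h n z) \<le> e / 2"
      using small[OF C0(1), of "e/2"] by (meson half_gt_zero)
    have "dist (h m 0) (h n 0) < e" if "m \<ge> N" "n \<ge> N" for m n
    proof -
      have "cmod (h m 0 - h n 0) \<le> C0 * nrm \<phi> (\<lambda>z. h m z - h n z)"
        by (rule C0(2)[OF A2_diff[OF h h]]) simp
      with N[OF that] \<open>0 < e\<close> show ?thesis unfolding dist_norm by linarith
    qed
    then show "\<exists>N. \<forall>m\<ge>N. \<forall>n\<ge>N. dist (h m 0) (h n 0) < e" by blast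
  qed
  then obtain l where l: "(\<lambda>n. h n 0) \<longlonglongrightarrow> l" using Cauchy_convergent_iff convergent_def by blast
  have loc: "\<exists>g. \<forall>z\<in>ball 0 R. (\<lambda>n. h n z) \<longlonglongrightarrow> g z \<and> (g has_derivative G z) (at z within ball 0 R)"
    if "0 < R" for R
  proof (rule has_derivative_sequence[where f=h and l=l])
    show "convex (ball (0::complex^'n) R)" by (rule convex_ball)
    show "(h n has_derivative frechet_derivative (h n) (at z)) (at z within ball 0 R)" for n z
      by (rule has_derivative_at_withinI[OF D])
    show "\<forall>\<^sub>F n in sequentially. \<forall>z\<in>ball 0 R. \<forall>w. cmod (frechet_derivative (h n) (at z) w - G z w) \<le> e * norm w"
      if e: "0 < e" for e
    proof -
      obtain N where N: "\<And>m n z w. m \<ge> N \<Longrightarrow> n \<ge> N \<Longrightarrow> z\<in>ball 0 R \<Longrightarrow> 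
         cmod (frechet_derivative (h m) (at z) w - frechet_derivative (h n) (at z) w) \<le> e * norm w"
        using Dunif[OF e] by blast
      have "cmod (frechet_derivative (h n) (at z) w - G z w) \<le> e * norm w"
        if "n \<ge> N" "z \<in> ball 0 R" for n z w
      proof (rule LIMSEQ_le_const2)
        show "(\<lambda>m. cmod (frechet_derivative (h n) (at z) w - frechet_derivative (h m) (at z) w)) \<longlonglongrightarrow>
          cmod (frechet_derivative (h n) (at z) w - G z w)"
          by (intro tendsto_intros G)
        show "\<exists>N. \<forall>m\<ge>N. cmod (frechet_derivative (h n) (at z) w - frechet_derivative (h m) (at z) w) \<le> e * norm w"
          using N that by blast
      qed
      then show ?thesis unfolding eventually_sequentially by blast
    qed
    show "0 \<in> ball (0::complex^'n) R" using that by simp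
    show "(\<lambda>n. h n 0) \<longlonglongrightarrow> l" by (rule l)
  qed
  \<comment> \<open>For each radius the limit function comes from a separate existence statement;
    the pointwise \<open>lim\<close> agrees with all of them and so glues them together.\<close>
  define g where "g z = lim (\<lambda>n. h n z)" for z
  have *: "(\<lambda>n. h n z) \<longlonglongrightarrow> g z \<and> (g has_derivative G z) (at z)" for z
  proof -
    have R: "0 < norm z + 1" by (simp add: add_nonneg_pos)
    obtain g' where g': "\<And>y. y \<in> ball 0 (norm z + 1) \<Longrightarrow> (\<lambda>n. h n y) \<longlonglongrightarrow> g' y"
      "\<And>y. y \<in> ball 0 (norm z + 1) \<Longrightarrow> (g' has_derivative G y) (at y within ball 0 (norm z + 1))"
      using loc[OF R] by blast
    have eq: "g y = g' y" if "y \<in> ball 0 (norm z + 1)" for y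
      unfolding g_def using g'(1)[OF that] by (rule limI)
    have z: "z \<in> ball 0 (norm z + 1)" by simp
    have "(g has_derivative G z) (at z)"
      using g'(2)[OF z] eq z
      by (subst at_within_open[symmetric, OF z open_ball]) (rule has_derivative_transform)
    with g'(1)[OF z] eq[OF z] show ?thesis by simp
  qed
  show ?thesis
  proof (rule that)
    show "entire g" unfolding entire_def using * Gc by blast
  qed (use * in blast)
qed

section \<open>Existence and properties of the orthogonal projection\<close>

text \<open>A minimizing sequence is Cauchy by the parallelogram law, hence has an entire pointwise
  limit. Fatou's lemma applied to the squared distances shows at once that this limit is square
  integrable and attains the infimum.\<close>

lemma A2_nearest:
  assumes F: "F \<in> L2 \<phi>"
  obtains h where "h \<in> A2 \<phi>"
    "\<And>g. g \<in> A2 \<phi> \<Longrightarrow> (nrm \<phi> (\<lambda>z. F z - h z))\<^sup>2 \<le> (nrm \<phi> (\<lambda>z. F z - g z))\<^sup>2"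
proof -
  define N where "N g = (nrm \<phi> (\<lambda>z. F z - g z))\<^sup>2" for g
  define d where "d = (INF g\<in>A2 \<phi>. N g)"
  have bdd: "bdd_below (N ` A2 \<phi>)" by (rule bdd_belowI[of _ 0]) (auto simp: N_def)
  have d: "d \<le> N g" if "g \<in> A2 \<phi>" for g
    unfolding d_def by (rule cINF_lower[OF bdd that])
  have "\<exists>g\<in>A2 \<phi>. N g < d + inverse (real (Suc n))" for n
  proof -
    have "d < d + inverse (real (Suc n))" by simp
    then show ?thesis unfolding d_def using cINF_less_iff[OF _ bdd] A2_0 by blast
  qed
  then obtain h where h: "\<And>n. h n \<in> A2 \<phi>" "\<And>n. N (h n) < d + inverse (real (Suc n))" by metis
  have diff: "(nrm \<phi> (\<lambda>z. h m z - h n z))\<^sup>2 \<le> 2 * inverse (real (Suc m)) + 2 * inverse (real (Suc n))" for m n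
  proof -
    \<comment> \<open>The midpoint lies in \<open>A2 \<phi>\<close>, so its squared distance from
      \<open>F\<close> is at least \<open>d\<close>. Both endpoints are within the inverse terms of
      \<open>d\<close>, and the parallelogram law then forces them close together.\<close>
    let ?a = "\<lambda>z. (1/2) * h n z + (1/2) * h m z"
    have a: "?a \<in> A2 \<phi>"
      using A2_add_scaled[OF A2_add_scaled[OF A2_0 h(1)] h(1), of "1/2" n "1/2" m] by simp
    have "(nrm \<phi> (\<lambda>z. (F z - h n z) - (F z - h m z)))\<^sup>2 =
      2 * N (h n) + 2 * N (h m) - (nrm \<phi> (\<lambda>z. (F z - h n z) + (F z - h m z)))\<^sup>2"
      unfolding N_def by (intro nrm_parallelogram L2_diff[OF F A2_L2[OF h(1)]])
    also have "(\<lambda>z. (F z - h n z) + (F z - h m z)) = (\<lambda>z. 2 * (F z - ?a z))"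
      by (auto simp: fun_eq_iff algebra_simps)
    also have "(nrm \<phi> (\<lambda>z. 2 * (F z - ?a z)))\<^sup>2 = 4 * N ?a"
      unfolding nrm_scaled_power2 N_def by simp
    finally show ?thesis using d[OF a] h(2)[of n] h(2)[of m] by simp
  qed
  have Cau: "\<exists>N. \<forall>m\<ge>N. \<forall>n\<ge>N. nrm \<phi> (\<lambda>z. h m z - h n z) < e" if "0 < e" for e
  proof -
    from that obtain K where K: "inverse (real (Suc K)) < e\<^sup>2 / 4"
      using reals_Archimedean[of "e\<^sup>2/4"] by auto
    have "nrm \<phi> (\<lambda>z. h m z - h n z) < e" if "m \<ge> K" "n \<ge> K" for m n
    proof -
      have "inverse (real (Suc m)) \<le> inverse (real (Suc K))" "inverse (real (Suc n)) \<le> inverse (real (Suc K))"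
        using that by (auto intro!: le_imp_inverse_le)
      then have "(nrm \<phi> (\<lambda>z. h m z - h n z))\<^sup>2 < e\<^sup>2" using diff[of m n] K by linarith
      then show ?thesis using \<open>0 < e\<close> by (auto intro: power_less_imp_less_base)
    qed
    then show ?thesis by blast
  qed
  obtain g where g: "entire g" "\<And>z. (\<lambda>n. h n z) \<longlonglongrightarrow> g z"
    using A2_Cauchy_limit[OF h(1) Cau] by blast
  have lim: "(\<lambda>n. d + inverse (real (Suc n))) \<longlonglongrightarrow> d"
    using tendsto_add[OF tendsto_const LIMSEQ_inverse_real_of_nat, of d] by simp
  have "integrable lborel (\<lambda>z. (cmod (F z - h n z))\<^sup>2 * exp (- \<phi> z))" for n
    by (rule L2_integrable[OF L2_diff[OF F A2_L2[OF h(1)]]])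
  moreover have "(\<lambda>n. (cmod (F z - h n z))\<^sup>2 * exp (- \<phi> z)) \<longlonglongrightarrow> (cmod (F z - g z))\<^sup>2 * exp (- \<phi> z)" for z
    by (intro tendsto_intros g)
  moreover have "(LINT z|lborel. (cmod (F z - h n z))\<^sup>2 * exp (- \<phi> z)) \<le> d + inverse (real (Suc n))" for n
    using h(2)[of n] by (simp add: N_def nrm_power2)
  ultimately have int: "integrable lborel (\<lambda>z. (cmod (F z - g z))\<^sup>2 * exp (- \<phi> z))"
    "(LINT z|lborel. (cmod (F z - g z))\<^sup>2 * exp (- \<phi> z)) \<le> d"
    using integrable_fatou[where s="\<lambda>n z. (cmod (F z - h n z))\<^sup>2 * exp (- \<phi> z)", OF _ _ _ _ lim] by auto
  have [measurable]: "g \<in> borel_measurable borel"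
    by (rule borel_measurable_continuous_onI[OF entire_continuous[OF g(1)]])
  note [measurable] = L2_measurable[OF F]
  have "(\<lambda>z. F z - g z) \<in> L2 \<phi>" using int by (simp add: L2_def)
  from L2_diff[OF F this] have "g \<in> L2 \<phi>" by simp
  then have "g \<in> A2 \<phi>" using g(1) by (simp add: A2_def)
  then show ?thesis
  proof (rule that)
    show "(nrm \<phi> (\<lambda>z. F z - g z))\<^sup>2 \<le> (nrm \<phi> (\<lambda>z. F z - f z))\<^sup>2" if "f \<in> A2 \<phi>" for f
      using d[OF that] int by (simp add: N_def nrm_power2)
  qed
qed

text \<open>A nonzero inner product \<open>p\<close> of the residual with some \<open>g\<close>
  would allow a small step along \<open>g\<close> to reduce the minimal distance.\<close>

lemma A2_orthogonal_exists:
  assumes F: "F \<in> L2 \<phi>"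
  shows "\<exists>h\<in>A2 \<phi>. \<forall>g\<in>A2 \<phi>. ip \<phi> (\<lambda>z. F z - h z) g = 0"
proof -
  obtain h where h: "h \<in> A2 \<phi>"
    "\<And>g. g \<in> A2 \<phi> \<Longrightarrow> (nrm \<phi> (\<lambda>z. F z - h z))\<^sup>2 \<le> (nrm \<phi> (\<lambda>z. F z - g z))\<^sup>2"
    using A2_nearest[OF F] by blast
  let ?r = "\<lambda>z. F z - h z"
  have r: "?r \<in> L2 \<phi>" by (rule L2_diff[OF F A2_L2[OF h(1)]])
  have "ip \<phi> ?r g = 0" if g: "g \<in> A2 \<phi>" for g
  proof (rule ccontr)
    assume "ip \<phi> ?r g \<noteq> 0"
    \<comment> \<open>With the step \<open>c = - t * p\<close> the first order gain is
      \<open>2 * t * (cmod p)^2\<close> and the second order loss is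
      \<open>t^2 * (cmod p)^2 * (nrm \<phi> g)^2\<close>. This \<open>t\<close> keeps the loss at no
      more than half the gain, and the added 1 covers \<open>nrm \<phi> g = 0\<close>.\<close>
    define p t where "p = ip \<phi> ?r g" and "t = 1 / ((nrm \<phi> g)\<^sup>2 + 1)"
    have pos: "0 < (nrm \<phi> g)\<^sup>2 + 1" by (simp add: add_nonneg_pos)
    then have t: "0 < t" "t * (nrm \<phi> g)\<^sup>2 \<le> 1" by (auto simp: t_def field_simps)
    define c where "c = - of_real t * p"
    have "(nrm \<phi> ?r)\<^sup>2 \<le> (nrm \<phi> (\<lambda>z. F z - (h z + (- c) * g z)))\<^sup>2"
      by (rule h(2)[OF A2_add_scaled[OF h(1) g]])
    also have "(\<lambda>z. F z - (h z + (- c) * g z)) = (\<lambda>z. ?r z + c * g z)" by auto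
    also have "(nrm \<phi> \<dots>)\<^sup>2 = (nrm \<phi> ?r)\<^sup>2 + 2 * Re (cnj c * p) + (cmod c)\<^sup>2 * (nrm \<phi> g)\<^sup>2"
      unfolding p_def by (rule nrm_add_scaled_power2[OF r A2_L2[OF g]])
    finally have "0 \<le> 2 * Re (cnj c * p) + (cmod c)\<^sup>2 * (nrm \<phi> g)\<^sup>2" by simp
    moreover have "Re (cnj c * p) = - t * (cmod p)\<^sup>2"
      by (simp add: c_def cmod_power2) (simp add: power2_eq_square algebra_simps)
    moreover have "(cmod c)\<^sup>2 = t\<^sup>2 * (cmod p)\<^sup>2" by (simp add: c_def norm_mult power_mult_distrib)
    ultimately have "0 \<le> 2 * (- t * (cmod p)\<^sup>2) + t\<^sup>2 * (cmod p)\<^sup>2 * (nrm \<phi> g)\<^sup>2" by metis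
    also have "\<dots> = t * (cmod p)\<^sup>2 * (t * (nrm \<phi> g)\<^sup>2 - 2)"
      by (simp add: power2_eq_square algebra_simps)
    finally have "0 \<le> t * (cmod p)\<^sup>2 * (t * (nrm \<phi> g)\<^sup>2 - 2)" .
    moreover have "0 < t * (cmod p)\<^sup>2" using t \<open>ip \<phi> ?r g \<noteq> 0\<close> by (simp add: p_def)
    ultimately have "0 \<le> t * (nrm \<phi> g)\<^sup>2 - 2" by (simp add: zero_le_mult_iff)
    with t show False by simp
  qed
  with h(1) show ?thesis by blast
qed

text \<open>The difference of two candidates is in \<open>A2 \<phi>\<close> and orthogonal to
  itself, so its norm is 0. The evaluation bound turns this into equality at every point, as the
  description by \<open>THE\<close> requires.\<close>

lemma bergman_proj:
  assumes F: "F \<in> L2 \<phi>"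
  shows bergman_proj_A2: "bergman_proj \<phi> F \<in> A2 \<phi>"
    and bergman_proj_orthogonal: "\<And>g. g \<in> A2 \<phi> \<Longrightarrow> ip \<phi> (\<lambda>z. F z - bergman_proj \<phi> F z) g = 0"
    and bergman_proj_unique: "\<And>h. h \<in> A2 \<phi> \<Longrightarrow> (\<And>g. g \<in> A2 \<phi> \<Longrightarrow> ip \<phi> (\<lambda>z. F z - h z) g = 0)
      \<Longrightarrow> bergman_proj \<phi> F = h"
proof -
  let ?P = "\<lambda>h. h \<in> A2 \<phi> \<and> (\<forall>g\<in>A2 \<phi>. ip \<phi> (\<lambda>z. F z - h z) g = 0)"
  have uniq: "h1 = h2" if "?P h1" "?P h2" for h1 h2
  proof -
    let ?k = "\<lambda>z. h1 z - h2 z"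
    have k: "?k \<in> A2 \<phi>" using that by (intro A2_diff) auto
    have "ip \<phi> (\<lambda>z. (F z - h2 z) - (F z - h1 z)) ?k = 0"
      using that k by (subst ip_diff_left) (auto intro: L2_diff[OF F] A2_L2)
    then have "ip \<phi> ?k ?k = 0" by simp
    then have n: "nrm \<phi> ?k = 0" by (simp add: ip_self)
    have "?k z = 0" for z
    proof -
      obtain C where "0 \<le> C" "\<And>h y. h \<in> A2 \<phi> \<Longrightarrow> norm y \<le> norm z \<Longrightarrow> cmod (h y) \<le> C * nrm \<phi> h"
        using A2_evaluation_bound by blast
      from this(2)[OF k, of z] n show ?thesis by simp
    qed
    then show ?thesis by (simp add: fun_eq_iff)
  qed
  obtain h where h: "?P h" using A2_orthogonal_exists[OF F] by fast
  have P: "?P (bergman_proj \<phi> F)"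
    unfolding bergman_proj_def by (rule theI[of ?P, OF h uniq[OF _ h]])
  then show "bergman_proj \<phi> F \<in> A2 \<phi>" "\<And>g. g \<in> A2 \<phi> \<Longrightarrow> ip \<phi> (\<lambda>z. F z - bergman_proj \<phi> F z) g = 0"
    by auto
  show "bergman_proj \<phi> F = h" if "h \<in> A2 \<phi>" "\<And>g. g \<in> A2 \<phi> \<Longrightarrow> ip \<phi> (\<lambda>z. F z - h z) g = 0" for h
    by (rule uniq[OF P]) (use that in auto)
qed

lemma bergman_compl_L2: "F \<in> L2 \<phi> \<Longrightarrow> bergman_compl \<phi> F \<in> L2 \<phi>"
  unfolding bergman_compl_def by (rule L2_diff[OF _ A2_L2[OF bergman_proj_A2]])

lemma bergman_compl_orthogonal: "F \<in> L2 \<phi> \<Longrightarrow> g \<in> A2 \<phi> \<Longrightarrow> ip \<phi> (bergman_compl \<phi> F) g = 0"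
  unfolding bergman_compl_def by (rule bergman_proj_orthogonal)

text \<open>Additivity follows from uniqueness. It identifies the sum of the complements of the
  \<open>v j\<close> with the complement of \<open>V\<close>.\<close>

lemma bergman_proj_sum:
  assumes "\<And>i. i \<in> I \<Longrightarrow> f i \<in> L2 \<phi>"
  shows "bergman_proj \<phi> (\<lambda>z. \<Sum>i\<in>I. f i z) = (\<lambda>z. \<Sum>i\<in>I. bergman_proj \<phi> (f i) z)"
proof (rule bergman_proj_unique)
  show "(\<lambda>z. \<Sum>i\<in>I. f i z) \<in> L2 \<phi>" by (rule L2_sum[OF assms])
  show "(\<lambda>z. \<Sum>i\<in>I. bergman_proj \<phi> (f i) z) \<in> A2 \<phi>" by (intro A2_sum bergman_proj_A2 assms)
  fix g assume g: "g \<in> A2 \<phi>"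
  have "ip \<phi> (\<lambda>z. \<Sum>i\<in>I. f i z - bergman_proj \<phi> (f i) z) g = 0"
    using assms g
    by (subst ip_sum_left) (auto intro: L2_diff A2_L2[OF bergman_proj_A2] A2_L2 simp: bergman_proj_orthogonal)
  then show "ip \<phi> (\<lambda>z. (\<Sum>i\<in>I. f i z) - (\<Sum>i\<in>I. bergman_proj \<phi> (f i) z)) g = 0"
    by (simp add: sum_subtractf)
qed

lemma bergman_compl_pythagoras:
  assumes "F \<in> L2 \<phi>"
  shows "(nrm \<phi> (bergman_compl \<phi> F))\<^sup>2 = (nrm \<phi> F)\<^sup>2 - (nrm \<phi> (bergman_proj \<phi> F))\<^sup>2"
proof -
  have "(\<lambda>z. bergman_compl \<phi> F z + 1 * bergman_proj \<phi> F z) = F"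
    by (simp add: bergman_compl_def)
  then show ?thesis
    using nrm_add_scaled_power2[of "bergman_compl \<phi> F" "bergman_proj \<phi> F" 1] assms
    by (simp add: bergman_compl_L2 A2_L2 bergman_proj_A2 bergman_compl_orthogonal)
qed

end


section \<open>The Levi form\<close>

definition C2 :: "('a::euclidean_space \<Rightarrow> 'b::real_normed_vector) \<Rightarrow> bool" where
  "C2 f \<longleftrightarrow> C1 f \<and> (\<forall>a. C1 (\<lambda>x. frechet_derivative f (at x) a))"

definition derivative2 :: "('a::euclidean_space \<Rightarrow> 'b::real_normed_vector) \<Rightarrow> 'a \<Rightarrow> 'a \<Rightarrow> 'a \<Rightarrow> 'b" where
  "derivative2 f x a c = frechet_derivative (\<lambda>y. frechet_derivative f (at y) a) (at x) c"

lemma C2_imp_C1: "C2 f \<Longrightarrow> C1 f" and C2_derivative: "C2 f \<Longrightarrow> C1 (\<lambda>x. frechet_derivative f (at x) a)"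
  by (auto simp: C2_def)

lemma smooth_imp_C2:
  assumes "smooth f"
  shows "C2 f"
proof -
  have "Ck (Suc (Suc 0)) f" using assms by (simp only: smooth_def)
  then have f: "C1 f" and "\<forall>b\<in>Basis. Ck (Suc 0) (\<lambda>x. frechet_derivative f (at x) b)"
    by (rule Ck_Suc_imp_C1, unfold Ck.simps(2)[of "Suc 0"], blast)
  then have b: "C1 (\<lambda>x. frechet_derivative f (at x) b)" if "b \<in> Basis" for b
    using that Ck_Suc_imp_C1 by blast
  have "C1 (\<lambda>x. frechet_derivative f (at x) a)" for a
    unfolding C1_derivative_Basis[OF f, of _ a]
    by (intro C1_sum C1_bounded_linear[OF _ bounded_linear_scaleR_right] b)
  with f show ?thesis by (simp add: C2_def)
qed

lemma derivative2_has_derivative: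
  "C2 f \<Longrightarrow> ((\<lambda>y. frechet_derivative f (at y) a) has_derivative derivative2 f x a) (at x)"
  unfolding derivative2_def[abs_def] by (rule C1_has_derivative[OF C2_derivative])

lemma linear_derivative2_right: "C2 f \<Longrightarrow> linear (derivative2 f x a)"
  using derivative2_has_derivative has_derivative_linear by blast

lemma linear_derivative2_left:
  assumes f: "C2 f"
  shows "linear (\<lambda>a. derivative2 f x a c)"
proof (rule linearI)
  note lin = C1_linear[OF C2_imp_C1[OF f]]
  show "derivative2 f x (a + b) c = derivative2 f x a c + derivative2 f x b c" for a b
    unfolding derivative2_def[of f x "a + b"] linear_add[OF lin]
    by (rule frechet_derivative_eqI[OF has_derivative_add[OF derivative2_has_derivative[OF f] derivative2_has_derivative[OF f]]])
  show "derivative2 f x (r *\<^sub>R a) c = r *\<^sub>R derivative2 f x a c" for r a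
    unfolding derivative2_def[of f x "r *\<^sub>R a"] linear_scale[OF lin]
    by (rule frechet_derivative_eqI[OF has_derivative_scaleR_right[OF derivative2_has_derivative[OF f]]])
qed

lemma continuous_on_derivative2:
  fixes p a c :: "'c::topological_space \<Rightarrow> 'a::euclidean_space"
  assumes f: "C2 f" and "continuous_on S p" "continuous_on S a" "continuous_on S c"
  shows "continuous_on S (\<lambda>y. derivative2 f (p y) (a y) (c y))"
proof -
  have eq: "derivative2 f x w c = (\<Sum>b\<in>Basis. (w \<bullet> b) *\<^sub>R derivative2 f x b c)" for x w c
  proof -
    note lin = linear_derivative2_left[OF f]
    have "derivative2 f x w c = derivative2 f x (\<Sum>b\<in>Basis. (w \<bullet> b) *\<^sub>R b) c"
      by (simp add: euclidean_representation)
    then show ?thesis by (simp add: linear_sum[OF lin] linear_scale[OF lin])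
  qed
  have "continuous_on S (\<lambda>y. \<Sum>b\<in>Basis. (a y \<bullet> b) *\<^sub>R derivative2 f (p y) b (c y))"
    unfolding derivative2_def
    by (intro continuous_on_sum continuous_on_scaleR continuous_on_inner continuous_on_const assms
        C1_continuous_derivative_joint C2_derivative)
  then show ?thesis by (rule continuous_on_eq) (rule eq[symmetric])
qed

section \<open>Symmetry of second derivatives\<close>

lemma C1_line_has_vector_derivative:
  assumes "C1 f"
  shows "((\<lambda>t. f (x + t *\<^sub>R a)) has_vector_derivative frechet_derivative f (at (x + t *\<^sub>R a)) a) (at t within T)"
proof -
  have "((\<lambda>t. f (x + t *\<^sub>R a)) has_derivative (\<lambda>h. frechet_derivative f (at (x + t *\<^sub>R a)) (h *\<^sub>R a))) (at t within T)"
    by (rule has_derivative_compose[OF _ C1_has_derivative[OF assms]])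
       (auto intro!: derivative_eq_intros)
  then show ?thesis
    unfolding has_vector_derivative_def linear_scale[OF C1_linear[OF assms]] .
qed

text \<open>
  \<open>\<partial>\<^sub>c f (x + s a) - \<partial>\<^sub>c f x\<close> is the integral of \<open>\<partial>\<^sub>c \<partial>\<^sub>a f\<close> over the segment, by differentiating the
  fundamental theorem of calculus in direction \<open>c\<close>; now differentiate in \<open>s\<close>.
\<close>

lemma derivative2_commute:
  fixes f :: "'a::euclidean_space \<Rightarrow> 'b::euclidean_space"
  assumes f: "C2 f"
  shows "derivative2 f x a c = derivative2 f x c a"
proof -
  note f1 = C2_imp_C1[OF f]
  let ?g = "\<lambda>t s. frechet_derivative f (at (x + t *\<^sub>R c + s *\<^sub>R a)) a"
  have main: "frechet_derivative f (at (x + s *\<^sub>R a)) c - frechet_derivative f (at x) c =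
      integral {0..s} (\<lambda>s. derivative2 f (x + s *\<^sub>R a) a c)" if "s \<in> {0..1}" for s
  proof -
    have ftc: "integral (cbox 0 s) (?g t) = f (x + s *\<^sub>R a + t *\<^sub>R c) - f (x + t *\<^sub>R c)" for t
    proof (rule integral_unique)
      have "(?g t has_integral f (x + t *\<^sub>R c + s *\<^sub>R a) - f (x + t *\<^sub>R c + 0 *\<^sub>R a)) {0..s}"
        by (rule fundamental_theorem_of_calculus) (use that C1_line_has_vector_derivative[OF f1] in auto)
      then show "(?g t has_integral f (x + s *\<^sub>R a + t *\<^sub>R c) - f (x + t *\<^sub>R c)) (cbox 0 s)"
        by (simp add: algebra_simps)
    qed
    have "((\<lambda>t. integral (cbox 0 s) (?g t)) has_vector_derivative
        integral (cbox 0 s) (\<lambda>s. derivative2 f (x + 0 *\<^sub>R c + s *\<^sub>R a) a c)) (at 0 within UNIV)"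
    proof (rule leibniz_rule_vector_derivative[where fx="\<lambda>t s. derivative2 f (x + t *\<^sub>R c + s *\<^sub>R a) a c"])
      show "((\<lambda>t. ?g t s) has_vector_derivative derivative2 f (x + t *\<^sub>R c + s *\<^sub>R a) a c) (at t within UNIV)" for t s
        using C1_line_has_vector_derivative[OF C2_derivative[OF f], of "x + s *\<^sub>R a" c a t]
        by (simp add: derivative2_def algebra_simps)
      show "?g t integrable_on cbox 0 s" for t
        by (intro integrable_continuous C1_continuous_derivative_joint f1 continuous_intros)
      show "continuous_on (UNIV \<times> cbox 0 s) (\<lambda>(t, s). derivative2 f (x + t *\<^sub>R c + s *\<^sub>R a) a c)"
        unfolding split_beta by (intro continuous_on_derivative2 f continuous_intros)
    qed auto
    moreover have "((\<lambda>t. integral (cbox 0 s) (?g t)) has_vector_derivative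
        frechet_derivative f (at (x + s *\<^sub>R a + 0 *\<^sub>R c)) c - frechet_derivative f (at (x + 0 *\<^sub>R c)) c) (at 0 within UNIV)"
      unfolding ftc by (intro has_vector_derivative_diff C1_line_has_vector_derivative f1)
    ultimately show ?thesis
      using vector_derivative_unique_at by fastforce
  qed
  \<comment> \<open>\<open>main\<close> covers \<open>s\<close> in the unit interval, so the
    comparison takes place at the endpoint 0 with one-sided derivatives, which are still
    unique.\<close>
  have "((\<lambda>s. integral {0..s} (\<lambda>s. derivative2 f (x + s *\<^sub>R a) a c)) has_vector_derivative
      derivative2 f (x + 0 *\<^sub>R a) a c) (at 0 within {0..1})"
    by (rule integral_has_vector_derivative) (auto intro!: continuous_on_derivative2 f continuous_intros)
  then have "((\<lambda>s. frechet_derivative f (at (x + s *\<^sub>R a)) c - frechet_derivative f (at x) c) has_vector_derivative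
      derivative2 f (x + 0 *\<^sub>R a) a c) (at 0 within {0..1})"
    by (rule has_vector_derivative_transform[rotated 2]) (auto simp: main)
  moreover have "((\<lambda>s. frechet_derivative f (at (x + s *\<^sub>R a)) c - frechet_derivative f (at x) c) has_vector_derivative
      derivative2 f (x + 0 *\<^sub>R a) c a - 0) (at 0 within {0..1})"
    unfolding derivative2_def
    by (intro has_vector_derivative_diff has_vector_derivative_const C1_line_has_vector_derivative C2_derivative f)
  ultimately show ?thesis
    using vector_derivative_unique_within_closed_interval[of 0 1 0] by fastforce
qed

section \<open>Circular means and positivity of the Levi form\<close>

lemma cis_scalar_mult: "cis t *s (w :: complex^'n) = cos t *\<^sub>R w + sin t *\<^sub>R (\<i> *s w)"
  by (simp add: vec_eq_iff complex_eq_iff)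

lemma continuous_on_cis_scalar_mult [continuous_intros]:
  assumes "continuous_on S f"
  shows "continuous_on S (\<lambda>t. cis (f t) *s (w :: complex^'n))"
proof -
  have "continuous_on UNIV (\<lambda>t. cis t *s w)"
    unfolding cis_scalar_mult by (intro continuous_intros)
  from continuous_on_compose2[OF this assms] show ?thesis by simp
qed

text \<open>
  The circular mean \<open>M r\<close> of radius \<open>r\<close> has \<open>M' 0 = 0\<close> and \<open>M'' 0\<close> equal to \<open>pi\<close> times the expression
  below, and \<open>M\<close> has a minimum at \<open>0\<close>.
\<close>

lemma plurisubharmonic_levi_nonneg:
  fixes \<phi> :: "complex^'n::finite \<Rightarrow> real"
  assumes f: "C2 \<phi>" and psh: "plurisubharmonic \<phi>"
  shows "0 \<le> derivative2 \<phi> z w w + derivative2 \<phi> z (\<i> *s w) (\<i> *s w)"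
proof (rule ccontr)
  assume neg: "\<not> ?thesis"
  note f1 = C2_imp_C1[OF f]
  define a where "a t = cis t *s w" for t
  have ca: "continuous_on S (\<lambda>x. a (g x))" if "continuous_on S g" for S and g :: "'b::topological_space \<Rightarrow> real"
    unfolding a_def by (intro continuous_intros that)
  have cf: "continuous_on S (\<lambda>x. \<phi> (g x))" if "continuous_on S g" for S and g :: "'b::topological_space \<Rightarrow> _"
    by (rule continuous_on_compose2[OF C1_continuous[OF f1] that]) auto
  define M where "M r = integral (cbox 0 (2*pi)) (\<lambda>t. \<phi> (z + r *\<^sub>R a t))" for r :: real
  define M1 where "M1 r = integral (cbox 0 (2*pi)) (\<lambda>t. frechet_derivative \<phi> (at (z + r *\<^sub>R a t)) (a t))" for r :: real
  have M: "(M has_vector_derivative M1 r) (at r within UNIV)" for r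
    unfolding M_def M1_def
  proof (rule leibniz_rule_vector_derivative[where fx="\<lambda>r t. frechet_derivative \<phi> (at (z + r *\<^sub>R a t)) (a t)"])
    show "((\<lambda>r. \<phi> (z + r *\<^sub>R a t)) has_vector_derivative frechet_derivative \<phi> (at (z + r *\<^sub>R a t)) (a t)) (at r within UNIV)" for r t
      by (rule C1_line_has_vector_derivative[OF f1])
    show "(\<lambda>t. \<phi> (z + r *\<^sub>R a t)) integrable_on cbox 0 (2*pi)" for r
      by (intro integrable_continuous cf ca continuous_intros)
    show "continuous_on (UNIV \<times> cbox 0 (2*pi)) (\<lambda>(r, t). frechet_derivative \<phi> (at (z + r *\<^sub>R a t)) (a t))"
      unfolding split_beta by (intro C1_continuous_derivative_joint f1 ca continuous_intros)
  qed auto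
  have M1: "(M1 has_vector_derivative integral (cbox 0 (2*pi)) (\<lambda>t. derivative2 \<phi> (z + 0 *\<^sub>R a t) (a t) (a t))) (at 0 within UNIV)"
    unfolding M1_def
  proof (rule leibniz_rule_vector_derivative[where fx="\<lambda>r t. derivative2 \<phi> (z + r *\<^sub>R a t) (a t) (a t)"])
    show "((\<lambda>r. frechet_derivative \<phi> (at (z + r *\<^sub>R a t)) (a t)) has_vector_derivative derivative2 \<phi> (z + r *\<^sub>R a t) (a t) (a t)) (at r within UNIV)" for r t
      unfolding derivative2_def by (rule C1_line_has_vector_derivative[OF C2_derivative[OF f]])
    show "(\<lambda>t. frechet_derivative \<phi> (at (z + r *\<^sub>R a t)) (a t)) integrable_on cbox 0 (2*pi)" for r
      by (intro integrable_continuous C1_continuous_derivative_joint f1 ca continuous_intros)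
    show "continuous_on (UNIV \<times> cbox 0 (2*pi)) (\<lambda>(r, t). derivative2 \<phi> (z + r *\<^sub>R a t) (a t) (a t))"
      unfolding split_beta by (intro continuous_on_derivative2 f ca continuous_intros)
  qed auto
  let ?A = "derivative2 \<phi> z w w" and ?C = "derivative2 \<phi> z (\<i> *s w) (\<i> *s w)"
  let ?B = "derivative2 \<phi> z w (\<i> *s w) + derivative2 \<phi> z (\<i> *s w) w"
  have "integral (cbox 0 (2*pi)) (\<lambda>t. derivative2 \<phi> z (a t) (a t)) = pi * (?A + ?C)"
  proof (rule integral_unique)
    have "derivative2 \<phi> z (a t) (a t) = (cos t)\<^sup>2 * ?A + cos t * sin t * ?B + (sin t)\<^sup>2 * ?C" for t
      unfolding a_def cis_scalar_mult
        linear_add[OF linear_derivative2_left[OF f]] linear_scale[OF linear_derivative2_left[OF f]]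
        linear_add[OF linear_derivative2_right[OF f]] linear_scale[OF linear_derivative2_right[OF f]]
      by (simp add: algebra_simps power2_eq_square)
    moreover
    \<comment> \<open>The coefficients are antiderivatives of \<open>(cos t)^2\<close>,
      \<open>cos t * sin t\<close> and \<open>(sin t)^2\<close>. Over a full period they increase by
      \<open>pi\<close>, 0 and \<open>pi\<close>, so the mixed second derivatives cancel.\<close>
    let ?H = "\<lambda>t. (t + sin t * cos t) / 2 * ?A + (sin t)\<^sup>2 / 2 * ?B + (t - sin t * cos t) / 2 * ?C"
    have "((\<lambda>t. (cos t)\<^sup>2 * ?A + cos t * sin t * ?B + (sin t)\<^sup>2 * ?C) has_integral ?H (2 * pi) - ?H 0) {0..2*pi}"
    proof (rule fundamental_theorem_of_calculus)
      fix t :: real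
      have s: "(sin t)\<^sup>2 = 1 - (cos t)\<^sup>2" by (rule sin_squared_eq)
      have "(?H has_real_derivative (1 + (cos t * cos t - sin t * sin t)) / 2 * ?A
          + cos t * sin t * ?B + (1 - (cos t * cos t - sin t * sin t)) / 2 * ?C) (at t within {0..2*pi})"
        by (auto intro!: derivative_eq_intros simp: field_simps)
      also have "(1 + (cos t * cos t - sin t * sin t)) / 2 = (cos t)\<^sup>2"
        using s by (simp add: power2_eq_square)
      also have "(1 - (cos t * cos t - sin t * sin t)) / 2 = (sin t)\<^sup>2"
        using s by (simp add: power2_eq_square)
      finally show "(?H has_vector_derivative (cos t)\<^sup>2 * ?A + cos t * sin t * ?B + (sin t)\<^sup>2 * ?C) (at t within {0..2*pi})"
        by (simp add: has_real_derivative_iff_has_vector_derivative)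
    qed simp
    ultimately show "((\<lambda>t. derivative2 \<phi> z (a t) (a t)) has_integral pi * (?A + ?C)) (cbox 0 (2*pi))"
      by (simp add: algebra_simps)
  qed
  then have "(M1 has_real_derivative pi * (?A + ?C)) (at 0)"
    using M1 by (simp add: has_real_derivative_iff_has_vector_derivative)
  moreover have "pi * (?A + ?C) < 0" using neg by (simp add: mult_pos_neg)
  \<comment> \<open>Since \<open>M1 0 = 0\<close> is shown next, \<open>M1\<close> is negative just
    to the right of 0; the mean value theorem then gives \<open>M (d / 2) < M 0\<close>, against the
    sub-mean value inequality for the vector \<open>(d / 2) *\<^sub>R w\<close>.\<close>
  ultimately obtain d where d: "d > 0" "\<And>h. 0 < h \<Longrightarrow> h < d \<Longrightarrow> M1 h < M1 0"
    using DERIV_neg_dec_right[of M1 "pi * (?A + ?C)" 0] by auto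
  have "integral (cbox 0 (2*pi)) (\<lambda>t. frechet_derivative \<phi> (at z) (a t)) = 0"
  proof (rule integral_unique)
    let ?P = "frechet_derivative \<phi> (at z) w" and ?Q = "frechet_derivative \<phi> (at z) (\<i> *s w)"
    let ?H = "\<lambda>t. sin t * ?P - cos t * ?Q"
    have "frechet_derivative \<phi> (at z) (a t) = cos t * ?P + sin t * ?Q" for t
      unfolding a_def cis_scalar_mult linear_add[OF C1_linear[OF f1]] linear_scale[OF C1_linear[OF f1]] by simp
    moreover have "((\<lambda>t. cos t * ?P + sin t * ?Q) has_integral ?H (2*pi) - ?H 0) {0..2*pi}"
      by (rule fundamental_theorem_of_calculus)
         (auto intro!: derivative_eq_intros simp flip: has_real_derivative_iff_has_vector_derivative)
    ultimately show "((\<lambda>t. frechet_derivative \<phi> (at z) (a t)) has_integral 0) (cbox 0 (2*pi))" by simp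
  qed
  then have M10: "M1 0 = 0" by (simp add: M1_def)
  have "\<exists>\<xi>>0. \<xi> < d / 2 \<and> M (d / 2) - M 0 = (d / 2 - 0) * M1 \<xi>"
    by (rule MVT2) (use d(1) M in \<open>auto simp: has_real_derivative_iff_has_vector_derivative\<close>)
  then obtain \<xi> where \<xi>: "0 < \<xi>" "\<xi> < d / 2" "M (d / 2) - M 0 = (d / 2) * M1 \<xi>" by auto
  then have "M1 \<xi> < 0" using d(2)[of \<xi>] d(1) M10 by simp
  then have "M (d / 2) < M 0" using \<xi>(3) d(1) mult_pos_neg[of "d/2" "M1 \<xi>"] by simp
  moreover have "M 0 \<le> M (d / 2)"
  proof -
    have "\<phi> z \<le> integral {0..2*pi} (\<lambda>t. \<phi> (z + cis t *s ((d / 2) *\<^sub>R w))) / (2 * pi)"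
      using psh unfolding plurisubharmonic_def by blast
    also have "(\<lambda>t. \<phi> (z + cis t *s ((d / 2) *\<^sub>R w))) = (\<lambda>t. \<phi> (z + (d / 2) *\<^sub>R a t))"
      unfolding a_def by (simp add: linear_scale[OF bounded_linear.linear[OF bounded_linear_complex_scalar_mult]])
    finally show ?thesis by (simp add: M_def field_simps)
  qed
  ultimately show False by simp
qed

section \<open>Wirtinger derivatives and the complex Hessian\<close>

lemma dz_eqI: "(f has_derivative D) (at z) \<Longrightarrow> dz k f z = (D (axis k 1) - \<i> * D (axis k \<i>)) / 2"
  by (simp add: dz_def frechet_derivative_eqI)

lemma phibar_eq:
  assumes "C1 \<phi>"
  shows "phibar \<phi> j z = (of_real (frechet_derivative \<phi> (at z) (axis j 1))
    + \<i> * of_real (frechet_derivative \<phi> (at z) (axis j \<i>))) / 2"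
  unfolding dzbar_def frechet_derivative_eqI[OF has_derivative_of_real[OF C1_has_derivative[OF assms]]] ..

lemma C1_phibar:
  assumes "C2 \<phi>"
  shows "C1 (phibar \<phi> j)"
  unfolding phibar_eq[OF C2_imp_C1[OF assms], abs_def] divide_inverse
  by (intro C1_mult C1_add C1_const C1_bounded_linear[OF _ bounded_linear_of_real] C2_derivative assms)

text \<open>These are the entries of the complex Hessian of \<open>\<phi>\<close>, expressed through
  the real one so that \<open>plurisubharmonic_levi_nonneg\<close> applies.\<close>

lemma dz_phibar:
  assumes f: "C2 \<phi>"
  shows "dz k (phibar \<phi> j) z = Complex
    ((derivative2 \<phi> z (axis j 1) (axis k 1) + derivative2 \<phi> z (axis j \<i>) (axis k \<i>)) / 4)
    ((derivative2 \<phi> z (axis j \<i>) (axis k 1) - derivative2 \<phi> z (axis j 1) (axis k \<i>)) / 4)"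
proof -
  have "(phibar \<phi> j has_derivative (\<lambda>b. (of_real (derivative2 \<phi> z (axis j 1) b)
    + \<i> * of_real (derivative2 \<phi> z (axis j \<i>) b)) / 2)) (at z)"
    unfolding phibar_eq[OF C2_imp_C1[OF f], abs_def]
    by (intro bounded_linear.has_derivative[OF bounded_linear_divide] has_derivative_add has_derivative_mult_right has_derivative_of_real derivative2_has_derivative f)
  then show ?thesis by (simp add: dz_eqI complex_eq_iff)
qed

text \<open>The second derivatives along \<open>w\<close> and \<open>\<i> *s w\<close> add up to
  four times the Levi form at \<open>w\<close>. Here \<open>w\<close> has entry \<alpha> in
  coordinate \<open>j\<close> and \<beta> in coordinate \<open>k\<close>; for \<open>j = k\<close>
  the entries add up and the formula persists.\<close>

lemma levi_quadratic:
  fixes \<phi> :: "complex^'n::finite \<Rightarrow> real"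
  assumes f: "C2 \<phi>" and psh: "plurisubharmonic \<phi>"
  shows "0 \<le> (cmod \<alpha>)\<^sup>2 * Re (dz j (phibar \<phi> j) z) + (cmod \<beta>)\<^sup>2 * Re (dz k (phibar \<phi> k) z)
    + 2 * Re (dz k (phibar \<phi> j) z * cnj \<alpha> * \<beta>)"
proof -
  define B where "B = derivative2 \<phi> z"
  note l = linear_derivative2_left[OF f, of z, folded B_def]
  note r = linear_derivative2_right[OF f, of z, folded B_def]
  have sym: "B x y = B y x" for x y unfolding B_def by (rule derivative2_commute[OF f])
  define j1 j2 k1 k2 :: "complex^'n" where "j1 = axis j 1" and "j2 = axis j \<i>" and "k1 = axis k 1" and "k2 = axis k \<i>"
  define w where "w = Re \<alpha> *\<^sub>R j1 + Im \<alpha> *\<^sub>R j2 + (Re \<beta> *\<^sub>R k1 + Im \<beta> *\<^sub>R k2)"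
  have iw: "\<i> *s w = (- Im \<alpha>) *\<^sub>R j1 + Re \<alpha> *\<^sub>R j2 + ((- Im \<beta>) *\<^sub>R k1 + Re \<beta> *\<^sub>R k2)"
    unfolding w_def j1_def j2_def k1_def k2_def by (simp add: vec_eq_iff axis_def complex_eq_iff)
  have "0 \<le> B w w + B (\<i> *s w) (\<i> *s w)"
    unfolding B_def by (rule plurisubharmonic_levi_nonneg[OF f psh])
  also have "\<dots> = ((Re \<alpha>)\<^sup>2 + (Im \<alpha>)\<^sup>2) * (B j1 j1 + B j2 j2) + ((Re \<beta>)\<^sup>2 + (Im \<beta>)\<^sup>2) * (B k1 k1 + B k2 k2)
    + 2 * ((Re \<alpha> * Re \<beta> + Im \<alpha> * Im \<beta>) * (B j1 k1 + B j2 k2) - (Re \<alpha> * Im \<beta> - Im \<alpha> * Re \<beta>) * (B j2 k1 - B j1 k2))"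
    unfolding iw unfolding w_def linear_add[OF l] linear_scale[OF l] linear_add[OF r] linear_scale[OF r]
      sym[of k1 j1] sym[of k1 j2] sym[of k2 j1] sym[of k2 j2] sym[of j2 j1] sym[of k2 k1]
    by (simp add: algebra_simps power2_eq_square)
  also have "\<dots> = 4 * ((cmod \<alpha>)\<^sup>2 * Re (dz j (phibar \<phi> j) z) + (cmod \<beta>)\<^sup>2 * Re (dz k (phibar \<phi> k) z)
    + 2 * Re (dz k (phibar \<phi> j) z * cnj \<alpha> * \<beta>))"
    unfolding dz_phibar[OF f] cmod_power2 B_def[symmetric] j1_def[symmetric] j2_def[symmetric]
      k1_def[symmetric] k2_def[symmetric]
    by (simp add: field_simps)
  finally show ?thesis by simp
qed

lemma levi_diagonal_nonneg:
  assumes "C2 \<phi>" "plurisubharmonic \<phi>"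
  shows "0 \<le> Re (dz j (phibar \<phi> j) z)" "Im (dz j (phibar \<phi> j) z) = 0"
  using levi_quadratic[OF assms, of 1 j z 0] derivative2_commute[OF assms(1), of z "axis j \<i>" "axis j 1"]
  by (simp_all add: dz_phibar[OF assms(1)])

text \<open>The rotations 1, -1, i and -i bound real and imaginary part by \<open>s / 2\<close>
  each. The best rotation would give \<open>s / 2\<close> for the modulus, but a constant factor is
  immaterial for integrability.\<close>

lemma cmod_le_of_rotations:
  assumes "\<And>\<theta>. cmod \<theta> = 1 \<Longrightarrow> 0 \<le> s + 2 * Re (\<theta> * x)"
  shows "cmod x \<le> s"
proof -
  have "\<bar>Re x\<bar> \<le> s / 2" "\<bar>Im x\<bar> \<le> s / 2"
    using assms[of 1] assms[of "-1"] assms[of \<i>] assms[of "-\<i>"] by (auto simp: abs_le_iff)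
  then show ?thesis using cmod_le[of x] by linarith
qed

text \<open>A nonnegative Hermitian form dominates its off-diagonal terms by its diagonal; the phase
  \<theta> is absorbed into the first vector entry.\<close>

lemma levi_bound:
  assumes "C2 \<phi>" "plurisubharmonic \<phi>"
  shows "cmod (dz k (phibar \<phi> j) z * a * cnj b) \<le>
    Re (dz j (phibar \<phi> j) z) * (cmod a)\<^sup>2 + Re (dz k (phibar \<phi> k) z) * (cmod b)\<^sup>2"
proof (rule cmod_le_of_rotations)
  fix \<theta> assume "cmod \<theta> = 1"
  with levi_quadratic[OF assms, of "cnj (\<theta> * a)" j z "cnj b" k]
  show "0 \<le> Re (dz j (phibar \<phi> j) z) * (cmod a)\<^sup>2 + Re (dz k (phibar \<phi> k) z) * (cmod b)\<^sup>2
      + 2 * Re (\<theta> * (dz k (phibar \<phi> j) z * a * cnj b))"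
    by (simp only: norm_mult complex_mod_cnj complex_cnj_cnj mult_1 mult_ac)
qed


section \<open>Integration by parts against cut-off functions\<close>

definition cutoff :: "nat \<Rightarrow> 'a::euclidean_space \<Rightarrow> real" where
  "cutoff n x = bump (inverse (real (Suc n)) *\<^sub>R x)"

lemma C1_cutoff: "C1 (cutoff n)"
  unfolding cutoff_def[abs_def] by (rule C1_scaleR_argument(1)[OF C1_bump])

lemma cutoff_nonneg: "0 \<le> cutoff n x" and cutoff_le_1: "cutoff n x \<le> 1"
  by (simp_all add: cutoff_def bump_nonneg bump_le_1)

lemma cutoff_eq_0: "real (Suc n) \<le> norm x \<Longrightarrow> cutoff n x = 0"
  unfolding cutoff_def by (rule bump_eq_0) (simp add: field_simps)

lemma cutoff_tendsto: "(\<lambda>n. cutoff n x) \<longlonglongrightarrow> 1"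
proof -
  have "(\<lambda>n. bump (inverse (real (Suc n)) *\<^sub>R x)) \<longlonglongrightarrow> bump (0 *\<^sub>R x)"
    by (rule continuous_on_tendsto_compose[OF C1_continuous[OF C1_bump]])
       (simp_all only: tendsto_scaleR[OF LIMSEQ_inverse_real_of_nat tendsto_const] UNIV_I eventually_True)
  then show ?thesis by (simp add: cutoff_def)
qed

lemma frechet_derivative_cutoff_le:
  "\<bar>frechet_derivative (cutoff n) (at x) b\<bar> \<le> 4 * norm b * inverse (real (Suc n))"
  unfolding cutoff_def[abs_def] C1_scaleR_argument(2)[OF C1_bump]
  using mult_right_mono[OF norm_frechet_derivative_bump_le[of "inverse (real (Suc n)) *\<^sub>R x" b], of "inverse (real (Suc n))"]
  by (simp add: abs_mult mult.commute)

lemma measurable_cutoff [measurable]: "cutoff n \<in> borel_measurable borel"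
  by (rule borel_measurable_continuous_onI[OF C1_continuous[OF C1_cutoff]])

lemma integrable_cutoff:
  fixes X :: "'a::euclidean_space \<Rightarrow> 'b::euclidean_space"
  assumes "continuous_on UNIV X"
  shows "integrable lborel (\<lambda>z. cutoff n z *\<^sub>R X z)"
proof (rule continuous_compact_support_integrable(1))
  show "continuous_on UNIV (\<lambda>z. cutoff n z *\<^sub>R X z)"
    by (intro continuous_intros assms C1_continuous C1_cutoff)
  show "cutoff n z *\<^sub>R X z = 0" if "z \<notin> cbox (- (real (Suc n) *\<^sub>R One)) (real (Suc n) *\<^sub>R One)" for z
    using norm_gt_of_notin_cbox[OF that] by (simp add: cutoff_eq_0)
qed

lemma integral_cutoff_tendsto:
  fixes X :: "'a::euclidean_space \<Rightarrow> 'b::euclidean_space"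
  assumes X: "integrable lborel X"
  shows "(\<lambda>n. LINT z|lborel. cutoff n z *\<^sub>R X z) \<longlonglongrightarrow> (LINT z|lborel. X z)"
proof (rule integral_dominated_convergence[where w="\<lambda>z. norm (X z)"])
  have [measurable]: "X \<in> borel_measurable borel" using X by auto
  show "X \<in> borel_measurable lborel" by measurable
  show "(\<lambda>z. cutoff n z *\<^sub>R X z) \<in> borel_measurable lborel" for n by measurable
  show "integrable lborel (\<lambda>z. norm (X z))" using X by simp
  have "(\<lambda>n. cutoff n z *\<^sub>R X z) \<longlonglongrightarrow> 1 *\<^sub>R X z" for z
    by (intro tendsto_scaleR cutoff_tendsto tendsto_const)
  then show "AE z in lborel. (\<lambda>n. cutoff n z *\<^sub>R X z) \<longlonglongrightarrow> X z" by simp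
  show "AE z in lborel. norm (cutoff n z *\<^sub>R X z) \<le> norm (X z)" for n
    by (intro AE_I2) (simp add: mult_left_le_one_le cutoff_nonneg cutoff_le_1)
qed

lemma dz_mult:
  assumes "C1 f" "C1 g"
  shows "dz k (\<lambda>z. f z * g z) z = dz k f z * g z + f z * dz k g z"
  unfolding dz_eqI[OF has_derivative_mult[OF C1_has_derivative[OF assms(1)] C1_has_derivative[OF assms(2)]]]
  by (simp add: dz_def field_simps)

lemma dz_diff:
  assumes "C1 f" "C1 g"
  shows "dz k (\<lambda>z. f z - g z) z = dz k f z - dz k g z"
  unfolding dz_eqI[OF has_derivative_diff[OF C1_has_derivative[OF assms(1)] C1_has_derivative[OF assms(2)]]]
  by (simp add: dz_def field_simps)

lemma continuous_on_dz: "C1 f \<Longrightarrow> continuous_on UNIV (dz k f)"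
  unfolding dz_def[abs_def] by (intro continuous_intros C1_continuous_derivative) simp_all

lemma axis_ii: "axis k \<i> = \<i> *s axis k 1"
  by (simp add: vec_eq_iff axis_def)

text \<open>The conjugate is antiholomorphic, so integration by parts against it transfers the
  derivative to the weight alone.\<close>

lemma dz_cnj_entire:
  assumes "entire u"
  shows "dz k (\<lambda>z. cnj (u z)) z = 0"
proof -
  have "dz k (\<lambda>z. cnj (u z)) z =
    (cnj (frechet_derivative u (at z) (axis k 1)) - \<i> * cnj (frechet_derivative u (at z) (axis k \<i>))) / 2"
    by (rule dz_eqI[OF has_derivative_cnj[OF entire_has_derivative[OF assms]]])
  then show ?thesis
    unfolding axis_ii entire_derivative_complex_linear[OF assms] by simp
qed

lemma C1_has_derivative_exp_minus:
  fixes \<phi> :: "'a::euclidean_space \<Rightarrow> real"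
  assumes "C1 \<phi>"
  shows "((\<lambda>z. exp (- \<phi> z)) has_derivative (\<lambda>b. exp (- \<phi> z) * - frechet_derivative \<phi> (at z) b)) (at z)"
  by (rule has_derivative_eq_rhs, rule has_derivative_exp, rule has_derivative_minus,
      rule C1_has_derivative[OF assms]) (simp add: mult.commute)

lemma C1_exp_minus:
  fixes \<phi> :: "'a::euclidean_space \<Rightarrow> real"
  assumes "C1 \<phi>"
  shows "C1 (\<lambda>z. exp (- \<phi> z))"
  by (rule C1I[OF C1_has_derivative_exp_minus[OF assms]])
     (intro continuous_intros C1_continuous C1_continuous_derivative assms)

text \<open>As \<open>\<phi>\<close> is real, its derivative in \<open>z_k\<close> is the conjugate
  of \<open>phibar \<phi> k\<close>. Hence the factor joins \<open>u\<close> in the conjugated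
  second slot of the inner product.\<close>

lemma dz_exp_minus:
  assumes "C1 \<phi>"
  shows "dz k (\<lambda>z. complex_of_real (exp (- \<phi> z))) z = - (cnj (phibar \<phi> k z) * complex_of_real (exp (- \<phi> z)))"
  unfolding dz_eqI[OF has_derivative_of_real[OF C1_has_derivative_exp_minus[OF assms]]] phibar_eq[OF assms]
  by (simp add: field_simps)

lemma integral_dz_eq_0:
  assumes F: "C1 F" "\<And>z. r \<le> norm z \<Longrightarrow> F z = 0"
  shows "integrable lborel (dz k F)" "(LINT z|lborel. dz k F z) = 0"
  using integral_derivative_eq_0[OF F] by (simp_all add: dz_def[abs_def])

lemma cmod_dz_cutoff_le:
  fixes z :: "complex^'n::finite"
  shows "cmod (dz k (\<lambda>z. complex_of_real (cutoff n z)) z) \<le> 4 * inverse (real (Suc n))"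
proof -
  have eq: "dz k (\<lambda>z. complex_of_real (cutoff n z)) z = (of_real (frechet_derivative (cutoff n) (at z) (axis k 1))
    - \<i> * of_real (frechet_derivative (cutoff n) (at z) (axis k \<i>))) / 2"
    by (rule dz_eqI[OF has_derivative_of_real[OF C1_has_derivative[OF C1_cutoff]]])
  have "cmod (of_real (frechet_derivative (cutoff n) (at z) (axis k 1))
    - \<i> * of_real (frechet_derivative (cutoff n) (at z) (axis k \<i>))) \<le>
    \<bar>frechet_derivative (cutoff n) (at z) (axis k 1)\<bar> + \<bar>frechet_derivative (cutoff n) (at z) (axis k \<i>)\<bar>"
    by (rule order_trans[OF norm_triangle_ineq4]) (simp add: norm_mult)
  moreover have "norm (axis k 1 :: complex^'n) = 1" "norm (axis k \<i> :: complex^'n) = 1"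
    by (simp_all add: norm_eq_sqrt_inner inner_axis_axis)
  ultimately show ?thesis
    using frechet_derivative_cutoff_le[of n z "axis k 1"] frechet_derivative_cutoff_le[of n z "axis k \<i>"]
    unfolding eq norm_divide by simp
qed

section \<open>Integration by parts in the weighted space\<close>

locale smooth_weight =
  fixes \<phi> :: "complex^'n::finite \<Rightarrow> real"
  assumes C2: "C2 \<phi>"

sublocale smooth_weight \<subseteq> continuous_weight
  by unfold_locales (rule C1_continuous[OF C2_imp_C1[OF C2]])

context smooth_weight
begin

text \<open>The integrand with \<open>dz k G\<close> is only assumed to be cut off, not integrable.
  This form is needed to derive integrability of the Levi diagonal; once integrability is available,
  \<open>ip_dz_left\<close> identifies the limit as an inner product.\<close>

lemma integral_cutoff_dz_tendsto:
  assumes G: "C1 G" "G \<in> L2 \<phi>" and u: "u \<in> A2 \<phi>" and w: "mult_op (phibar \<phi> k) u \<in> L2 \<phi>"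
  shows "(\<lambda>n. LINT z|lborel. cutoff n z *\<^sub>R (dz k G z * cnj (u z) * complex_of_real (exp (- \<phi> z))))
    \<longlonglongrightarrow> ip \<phi> G (mult_op (phibar \<phi> k) u)"
proof -
  note eu = A2_entire[OF u] and f1 = C2_imp_C1[OF C2]
  define e where "e z = complex_of_real (exp (- \<phi> z))" for z
  define Y where "Y z = G z * cnj (u z) * e z" for z
  define X where "X z = G z * cnj (mult_op (phibar \<phi> k) u z) * e z" for z
  define D where "D z = dz k G z * cnj (u z) * e z" for z
  have Ce: "C1 e" unfolding e_def[abs_def]
    by (rule C1_bounded_linear[OF C1_exp_minus[OF f1] bounded_linear_of_real])
  have Cu: "C1 (\<lambda>z. cnj (u z))" by (rule C1_bounded_linear[OF entire_C1[OF eu] bounded_linear_cnj])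
  have CY: "C1 Y" unfolding Y_def[abs_def] by (intro C1_mult G(1) Cu Ce)
  have Cc: "C1 (\<lambda>z. complex_of_real (cutoff n z))" for n
    by (rule C1_bounded_linear[OF C1_cutoff bounded_linear_of_real])
  have dzY: "dz k Y z = D z - X z" for z
    unfolding Y_def[abs_def] dz_mult[OF C1_mult[OF G(1) Cu] Ce] dz_mult[OF G(1) Cu] dz_cnj_entire[OF eu]
    unfolding e_def[abs_def] dz_exp_minus[OF f1] D_def X_def mult_op_def by (simp add: e_def)
  have intX: "integrable lborel X"
    using L2_ip_exists[OF G(2) w] unfolding X_def[abs_def] e_def ip_exists_def .
  have intY: "integrable lborel Y"
    using L2_ip_exists[OF G(2) A2_L2[OF u]] unfolding Y_def[abs_def] e_def ip_exists_def .
  have cD: "continuous_on UNIV D" unfolding D_def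
    by (intro continuous_intros continuous_on_dz G C1_continuous[OF Cu] C1_continuous[OF Ce])
  let ?dc = "\<lambda>n z. dz k (\<lambda>z. complex_of_real (cutoff n z)) z"
  have eq: "(LINT z|lborel. cutoff n z *\<^sub>R D z) = (LINT z|lborel. cutoff n z *\<^sub>R X z) - (LINT z|lborel. ?dc n z * Y z)"
    and int_dc: "integrable lborel (\<lambda>z. ?dc n z * Y z)" for n
  proof -
    \<comment> \<open>The integral of \<open>dz k ?F\<close> vanishes by compact support. Its
      Leibniz terms are \<open>D\<close>, the weight term \<open>- X\<close>, and the derivative of
      the cut-off times the integrable function \<open>Y\<close>.\<close>
    let ?F = "\<lambda>z. complex_of_real (cutoff n z) * Y z"
    have dF: "dz k ?F z = ?dc n z * Y z + (cutoff n z *\<^sub>R D z - cutoff n z *\<^sub>R X z)" for z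
      unfolding dz_mult[OF Cc CY] dzY by (simp add: scaleR_conv_of_real algebra_simps)
    have F: "C1 ?F" "\<And>z. real (Suc n) \<le> norm z \<Longrightarrow> ?F z = 0"
      by (rule C1_mult[OF Cc CY]) (simp add: cutoff_eq_0)
    have iX: "integrable lborel (\<lambda>z. cutoff n z *\<^sub>R X z)"
    proof (rule Bochner_Integration.integrable_bound[OF intX])
      have [measurable]: "X \<in> borel_measurable borel" using intX by auto
      show "(\<lambda>z. cutoff n z *\<^sub>R X z) \<in> borel_measurable lborel" by measurable
      show "AE z in lborel. norm (cutoff n z *\<^sub>R X z) \<le> norm (X z)"
        by (intro AE_I2) (simp add: mult_left_le_one_le cutoff_nonneg cutoff_le_1)
    qed
    have iD: "integrable lborel (\<lambda>z. cutoff n z *\<^sub>R D z)" by (rule integrable_cutoff[OF cD])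
    have "integrable lborel (dz k ?F)" "(LINT z|lborel. dz k ?F z) = 0"
      by (rule integral_dz_eq_0[OF F(1)], rule F(2), assumption)+
    note dzF = this[unfolded dF[abs_def]]
    have iF: "integrable lborel (\<lambda>z. ?dc n z * Y z + (cutoff n z *\<^sub>R D z - cutoff n z *\<^sub>R X z))"
      by (rule dzF(1))
    have "integrable lborel (\<lambda>z. (?dc n z * Y z + (cutoff n z *\<^sub>R D z - cutoff n z *\<^sub>R X z)) - (cutoff n z *\<^sub>R D z - cutoff n z *\<^sub>R X z))"
      by (intro Bochner_Integration.integrable_diff iF iD iX)
    then show iY: "integrable lborel (\<lambda>z. ?dc n z * Y z)" by simp
    have "(LINT z|lborel. ?dc n z * Y z) + ((LINT z|lborel. cutoff n z *\<^sub>R D z) - (LINT z|lborel. cutoff n z *\<^sub>R X z)) = 0"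
      using dzF(2) iD iX iY
      by (simp add: Bochner_Integration.integral_add Bochner_Integration.integral_diff Bochner_Integration.integrable_diff)
    then show "(LINT z|lborel. cutoff n z *\<^sub>R D z) = (LINT z|lborel. cutoff n z *\<^sub>R X z) - (LINT z|lborel. ?dc n z * Y z)"
      by (simp add: algebra_simps eq_neg_iff_add_eq_0)
  qed
  have "(\<lambda>n. LINT z|lborel. ?dc n z * Y z) \<longlonglongrightarrow> 0"
  proof (rule Lim_null_comparison)
    let ?K = "LINT z|lborel. norm (Y z)"
    show "\<forall>\<^sub>F n in sequentially. norm (LINT z|lborel. ?dc n z * Y z) \<le> inverse (real (Suc n)) * (4 * ?K)"
    proof (rule always_eventually, rule allI)
      fix n
      have "norm (LINT z|lborel. ?dc n z * Y z) \<le> (LINT z|lborel. 4 * inverse (real (Suc n)) * norm (Y z))"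
      proof (rule Bochner_Integration.integral_norm_bound_integral[OF int_dc])
        show "integrable lborel (\<lambda>z. 4 * inverse (real (Suc n)) * norm (Y z))"
          using intY by (intro integrable_mult_right integrable_norm)
        show "norm (?dc n z * Y z) \<le> 4 * inverse (real (Suc n)) * norm (Y z)" for z
          unfolding norm_mult by (intro mult_right_mono cmod_dz_cutoff_le) simp
      qed
      then show "norm (LINT z|lborel. ?dc n z * Y z) \<le> inverse (real (Suc n)) * (4 * ?K)"
        by (simp add: mult_ac)
    qed
    show "(\<lambda>n. inverse (real (Suc n)) * (4 * ?K)) \<longlonglongrightarrow> 0"
      using tendsto_mult_right[OF LIMSEQ_inverse_real_of_nat, of "4 * ?K"] by simp
  qed
  then have "(\<lambda>n. LINT z|lborel. cutoff n z *\<^sub>R D z) \<longlonglongrightarrow> (LINT z|lborel. X z) - 0"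
    unfolding eq by (intro tendsto_diff integral_cutoff_tendsto intX)
  then show ?thesis by (simp add: D_def X_def e_def ip_def)
qed

lemma ip_dz_left:
  assumes "C1 G" "G \<in> L2 \<phi>" "u \<in> A2 \<phi>" "mult_op (phibar \<phi> k) u \<in> L2 \<phi>" "ip_exists \<phi> (dz k G) u"
  shows "ip \<phi> (dz k G) u = ip \<phi> G (mult_op (phibar \<phi> k) u)"
  using integral_cutoff_tendsto[OF assms(5)[unfolded ip_exists_def]] integral_cutoff_dz_tendsto[OF assms(1-4)]
  unfolding ip_def[of \<phi> "dz k G"] by (rule LIMSEQ_unique)

section \<open>Integrability of the Levi terms and the commutator identity\<close>

lemma dz_mult_phibar:
  assumes "entire u"
  shows "dz k (mult_op (phibar \<phi> j) u) z = dz k (phibar \<phi> j) z * u z + phibar \<phi> j z * dz k u z"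
  unfolding mult_op_def by (rule dz_mult[OF C1_phibar[OF C2] entire_C1[OF assms]])

lemma commutator_mult_phibar:
  assumes "entire u"
  shows "commutator (dz k) (mult_op (phibar \<phi> j)) u z = dz k (phibar \<phi> j) z * u z"
  unfolding commutator_def dz_mult_phibar[OF assms] by (simp add: mult_op_def)

text \<open>
  Integration by parts of \<open>\<partial>\<^sub>k v\<^sub>k\<close> against \<open>u\<close> bounds the cut-off integrals of the nonnegative
  diagonal Levi term, so Fatou's lemma applies.
\<close>

lemma integrable_levi_diagonal:
  assumes psh: "plurisubharmonic \<phi>" and u: "u \<in> A2 \<phi>" and v: "mult_op (phibar \<phi> k) u \<in> L2 \<phi>"
    and w: "mult_op (phibar \<phi> k) (dz k u) \<in> L2 \<phi>"
  shows "integrable lborel (\<lambda>z. Re (dz k (phibar \<phi> k) z) * (cmod (u z))\<^sup>2 * exp (- \<phi> z))"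
proof -
  note eu = A2_entire[OF u]
  define W where "W z = mult_op (phibar \<phi> k) (dz k u) z * cnj (u z) * complex_of_real (exp (- \<phi> z))" for z
  define D where "D z = dz k (mult_op (phibar \<phi> k) u) z * cnj (u z) * complex_of_real (exp (- \<phi> z))" for z
  define L where "L z = Re (dz k (phibar \<phi> k) z) * (cmod (u z))\<^sup>2 * exp (- \<phi> z)" for z
  have cu: "continuous_on UNIV u" by (rule entire_continuous[OF eu])
  have Cv: "C1 (mult_op (phibar \<phi> k) u)"
    unfolding mult_op_def by (intro C1_mult C1_phibar C2 entire_C1 eu)
  have cD: "continuous_on UNIV D" unfolding D_def
    by (intro continuous_intros continuous_on_dz[OF Cv] cu continuous)
  have cW: "continuous_on UNIV W" unfolding W_def mult_op_def
    by (intro continuous_intros continuous_on_dz[OF entire_C1[OF eu]] C1_continuous[OF C1_phibar[OF C2]] cu continuous)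
  have cL: "continuous_on UNIV L" unfolding L_def
    by (intro continuous_intros continuous_on_dz[OF C1_phibar[OF C2]] cu continuous)
  \<comment> \<open>In the Leibniz rule for \<open>D\<close>, the derivative falling on
    \<open>u\<close> gives \<open>W\<close>, integrable by assumption \<open>w\<close>. The
    remainder is the diagonal Levi term, real by symmetry of second derivatives, so cut-off limits
    for \<open>D\<close> and \<open>W\<close> yield one for \<open>L\<close>.\<close>
  have L: "complex_of_real (L z) = D z - W z" for z
  proof -
    have "dz k (phibar \<phi> k) z = complex_of_real (Re (dz k (phibar \<phi> k) z))"
      using levi_diagonal_nonneg(2)[OF C2 psh] by (simp add: complex_eq_iff)
    moreover have "D z - W z = dz k (phibar \<phi> k) z * (u z * cnj (u z)) * complex_of_real (exp (- \<phi> z))"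
      unfolding D_def W_def dz_mult_phibar[OF eu] by (simp add: mult_op_def algebra_simps)
    ultimately show ?thesis unfolding L_def complex_norm_square[symmetric] by (metis of_real_mult)
  qed
  have "(\<lambda>n. (LINT z|lborel. cutoff n z *\<^sub>R D z) - (LINT z|lborel. cutoff n z *\<^sub>R W z)) \<longlonglongrightarrow>
     ip \<phi> (mult_op (phibar \<phi> k) u) (mult_op (phibar \<phi> k) u) - (LINT z|lborel. W z)"
    unfolding D_def
    by (intro tendsto_diff integral_cutoff_dz_tendsto[OF Cv v u v] integral_cutoff_tendsto)
       (use L2_ip_exists[OF w A2_L2[OF u]] in \<open>simp add: W_def[abs_def] ip_exists_def\<close>)
  moreover have "(LINT z|lborel. cutoff n z *\<^sub>R D z) - (LINT z|lborel. cutoff n z *\<^sub>R W z) =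
      complex_of_real (LINT z|lborel. cutoff n z * L z)" for n
  proof -
    have "(LINT z|lborel. cutoff n z *\<^sub>R D z) - (LINT z|lborel. cutoff n z *\<^sub>R W z) =
        (LINT z|lborel. cutoff n z *\<^sub>R D z - cutoff n z *\<^sub>R W z)"
      by (intro Bochner_Integration.integral_diff[symmetric] integrable_cutoff cD cW)
    also have "\<dots> = (LINT z|lborel. complex_of_real (cutoff n z * L z))"
      by (intro Bochner_Integration.integral_cong) (simp_all add: L scaleR_conv_of_real algebra_simps)
    also have "\<dots> = complex_of_real (LINT z|lborel. cutoff n z * L z)"
      by (rule integral_complex_of_real)
    finally show ?thesis .
  qed
  ultimately have "(\<lambda>n. Re (complex_of_real (LINT z|lborel. cutoff n z * L z))) \<longlonglongrightarrow>
     Re (ip \<phi> (mult_op (phibar \<phi> k) u) (mult_op (phibar \<phi> k) u) - (LINT z|lborel. W z))"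
    by (intro tendsto_Re) simp
  then have lim: "(\<lambda>n. LINT z|lborel. cutoff n z * L z) \<longlonglongrightarrow>
     Re (ip \<phi> (mult_op (phibar \<phi> k) u) (mult_op (phibar \<phi> k) u) - (LINT z|lborel. W z))"
    by simp
  have "integrable lborel L"
  proof (rule integrable_fatou(1)[OF _ _ _ order_refl lim])
    show "integrable lborel (\<lambda>z. cutoff n z * L z)" for n
      using integrable_cutoff[OF cL] by simp
    show "0 \<le> cutoff n z * L z" for n z
      unfolding L_def
      by (intro mult_nonneg_nonneg cutoff_nonneg levi_diagonal_nonneg(1)[OF C2 psh]) simp_all
    show "(\<lambda>n. cutoff n z * L z) \<longlonglongrightarrow> L z" for z
      using tendsto_mult_right[OF cutoff_tendsto[of z], of "L z"] by simp
  qed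
  then show ?thesis by (simp add: L_def[abs_def])
qed

lemma ip_exists_levi:
  assumes psh: "plurisubharmonic \<phi>" and u: "a \<in> A2 \<phi>" "b \<in> A2 \<phi>"
    and v: "mult_op (phibar \<phi> j) a \<in> L2 \<phi>" "mult_op (phibar \<phi> k) b \<in> L2 \<phi>"
    and w: "mult_op (phibar \<phi> j) (dz j a) \<in> L2 \<phi>" "mult_op (phibar \<phi> k) (dz k b) \<in> L2 \<phi>"
  shows "ip_exists \<phi> (\<lambda>z. dz k (phibar \<phi> j) z * a z) b"
  unfolding ip_exists_def
proof (rule Bochner_Integration.integrable_bound)
  show "integrable lborel (\<lambda>z. Re (dz j (phibar \<phi> j) z) * (cmod (a z))\<^sup>2 * exp (- \<phi> z)
    + Re (dz k (phibar \<phi> k) z) * (cmod (b z))\<^sup>2 * exp (- \<phi> z))"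
    by (intro Bochner_Integration.integrable_add integrable_levi_diagonal assms)
  show "(\<lambda>z. dz k (phibar \<phi> j) z * a z * cnj (b z) * complex_of_real (exp (- \<phi> z))) \<in> borel_measurable lborel"
    by (simp, intro borel_measurable_continuous_onI continuous_intros continuous_on_dz[OF C1_phibar[OF C2]]
        entire_continuous[OF A2_entire] u continuous)
  show "AE z in lborel. norm (dz k (phibar \<phi> j) z * a z * cnj (b z) * complex_of_real (exp (- \<phi> z)))
    \<le> norm (Re (dz j (phibar \<phi> j) z) * (cmod (a z))\<^sup>2 * exp (- \<phi> z) + Re (dz k (phibar \<phi> k) z) * (cmod (b z))\<^sup>2 * exp (- \<phi> z))"
  proof (intro AE_I2)
    fix z
    have "cmod (dz k (phibar \<phi> j) z * a z * cnj (b z)) * exp (- \<phi> z) \<le>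
      (Re (dz j (phibar \<phi> j) z) * (cmod (a z))\<^sup>2 + Re (dz k (phibar \<phi> k) z) * (cmod (b z))\<^sup>2) * exp (- \<phi> z)"
      by (intro mult_right_mono levi_bound C2 psh) simp
    also have "\<dots> \<le> norm \<dots>" by simp
    finally show "norm (dz k (phibar \<phi> j) z * a z * cnj (b z) * complex_of_real (exp (- \<phi> z)))
      \<le> norm (Re (dz j (phibar \<phi> j) z) * (cmod (a z))\<^sup>2 * exp (- \<phi> z) + Re (dz k (phibar \<phi> k) z) * (cmod (b z))\<^sup>2 * exp (- \<phi> z))"
      by (simp add: norm_mult distrib_right)
  qed
qed

text \<open>Removing the cut-off requires integrability of \<open>dz k G\<close> against
  \<open>b\<close>. It is assembled from three pieces: the first commutator by the Levi bound, the
  second by assumption \<open>ex\<close>, and the remainder because both factors are square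
  integrable.\<close>

lemma ip_bergman_compl_eq_commutators:
  assumes psh: "plurisubharmonic \<phi>" and u: "a \<in> A2 \<phi>" "b \<in> A2 \<phi>"
    and v: "mult_op (phibar \<phi> j) a \<in> L2 \<phi>" "mult_op (phibar \<phi> k) b \<in> L2 \<phi>"
    and w: "mult_op (phibar \<phi> j) (dz j a) \<in> L2 \<phi>" "mult_op (phibar \<phi> k) (dz k b) \<in> L2 \<phi>"
      "mult_op (phibar \<phi> j) (dz k a) \<in> L2 \<phi>"
    and ex: "ip_exists \<phi> (commutator (dz k) (bergman_proj \<phi> \<circ> mult_op (phibar \<phi> j)) a) b"
  shows "ip \<phi> (bergman_compl \<phi> (mult_op (phibar \<phi> j) a)) (mult_op (phibar \<phi> k) b) =
    ip \<phi> (commutator (dz k) (mult_op (phibar \<phi> j)) a) b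
    - ip \<phi> (commutator (dz k) (bergman_proj \<phi> \<circ> mult_op (phibar \<phi> j)) a) b"
proof -
  define v' where "v' = mult_op (phibar \<phi> j) a"
  define w' where "w' = mult_op (phibar \<phi> j) (dz k a)"
  define G where "G = bergman_compl \<phi> v'"
  define c1 where "c1 = commutator (dz k) (mult_op (phibar \<phi> j)) a"
  define c2 where "c2 = commutator (dz k) (bergman_proj \<phi> \<circ> mult_op (phibar \<phi> j)) a"
  have v'L2: "v' \<in> L2 \<phi>" and w'L2: "w' \<in> L2 \<phi>" using v w by (auto simp: v'_def w'_def)
  note eP = A2_entire[OF bergman_proj_A2[OF v'L2]]
  have Cv': "C1 v'" unfolding v'_def mult_op_def
    by (intro C1_mult C1_phibar C2 entire_C1 A2_entire u)
  have G: "C1 G" "G \<in> L2 \<phi>"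
    unfolding G_def using Cv' bergman_compl_L2[OF v'L2]
    by (auto simp: bergman_compl_def intro: C1_diff entire_C1[OF eP])
  \<comment> \<open>The commutators subtract \<open>w'\<close> and its projection respectively, so
    their difference falls short of \<open>dz k G\<close> by exactly the complement of
    \<open>w'\<close>, which is orthogonal to \<open>b\<close>.\<close>
  have dG: "dz k G z = c1 z - c2 z + bergman_compl \<phi> w' z" for z
  proof -
    have "dz k G z = dz k v' z - dz k (bergman_proj \<phi> v') z"
      unfolding G_def bergman_compl_def by (rule dz_diff[OF Cv' entire_C1[OF eP]])
    then show ?thesis
      by (simp add: c1_def c2_def commutator_def bergman_compl_def v'_def w'_def)
  qed
  let ?I = "\<lambda>f z. f z * cnj (b z) * complex_of_real (exp (- \<phi> z))"
  have i1: "integrable lborel (?I c1)"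
    using ip_exists_levi[OF psh u v w(1,2)]
    unfolding c1_def commutator_mult_phibar[OF A2_entire[OF u(1)]] ip_exists_def .
  have i2: "integrable lborel (?I c2)"
    using ex unfolding c2_def ip_exists_def .
  have i3: "integrable lborel (?I (bergman_compl \<phi> w'))"
    using L2_ip_exists[OF bergman_compl_L2[OF w'L2] A2_L2[OF u(2)]] unfolding ip_exists_def .
  have eq: "?I (dz k G) = (\<lambda>z. ?I c1 z - ?I c2 z + ?I (bergman_compl \<phi> w') z)"
    unfolding dG by (auto simp: algebra_simps)
  have "ip_exists \<phi> (dz k G) b"
    unfolding ip_exists_def eq
    by (intro Bochner_Integration.integrable_add Bochner_Integration.integrable_diff i1 i2 i3)
  then have "ip \<phi> G (mult_op (phibar \<phi> k) b) = ip \<phi> (dz k G) b"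
    by (intro ip_dz_left[symmetric] G u v)
  also have "\<dots> = ip \<phi> c1 b - ip \<phi> c2 b + ip \<phi> (bergman_compl \<phi> w') b"
    unfolding ip_def eq using i1 i2 i3 by simp
  also have "ip \<phi> (bergman_compl \<phi> w') b = 0"
    by (rule bergman_compl_orthogonal[OF w'L2 u(2)])
  finally show ?thesis by (simp add: G_def v'_def c1_def c2_def)
qed

end

text \<open>The coefficient of \<open>dz_j\<close> is \<open>u {j}\<close>, and the adjoint acting
  on 1-forms belongs to the operator on 0-forms, hence \<open>dom_del_star \<phi> 0\<close>. The
  commutator formula is an implication whose premise gives meaning to its terms: the projection is
  applied to square integrable functions and the second family of inner products exists. Existence
  of the first family is derived.\<close>

theorem theorem3p4:
  fixes \<phi> :: "complex^('n::{finite,linorder}) \<Rightarrow> real"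
    and u :: "'n form"
    and v :: "'n \<Rightarrow> 'n cfun"
    and V :: "'n cfun"
    and Q :: complex
  assumes smooth: "smooth \<phi>"
    and psh: "plurisubharmonic \<phi>"
    and u: "u \<in> A2_form \<phi> 1"
    and u_dom: "u \<in> dom_del \<phi> 1 \<inter> dom_del_star \<phi> 0"
    and v_def: "\<And>j. v j = mult_op (phibar \<phi> j) (u {j})"
    and V_def: "V = (\<lambda>z. \<Sum>j\<in>UNIV. v j z)"
    and Q_def: "Q = (\<Sum>j\<in>UNIV. \<Sum>k\<in>UNIV. ip \<phi> (\<lambda>z. v j z - bergman_proj \<phi> (v j) z) (v k))"
    and v_L2: "\<And>j. v j \<in> L2 \<phi>"
  shows "(Q \<in> \<real> \<and> 0 \<le> Re Q) \<and>
    ((\<forall>j k. mult_op (phibar \<phi> j) (dz k (u {j})) \<in> L2 \<phi> \<and>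
            ip_exists \<phi> (commutator (dz k) (bergman_proj \<phi> \<circ> mult_op (phibar \<phi> j)) (u {j})) (u {k}))
      \<longrightarrow>
      Q = (\<Sum>j\<in>UNIV. \<Sum>k\<in>UNIV.
             ip \<phi> (commutator (dz k) (mult_op (phibar \<phi> j)) (u {j})) (u {k}))
        - (\<Sum>j\<in>UNIV. \<Sum>k\<in>UNIV.
             ip \<phi> (commutator (dz k) (bergman_proj \<phi> \<circ> mult_op (phibar \<phi> j)) (u {j})) (u {k}))) \<and>
    Q = complex_of_real ((nrm \<phi> (\<lambda>z. \<Sum>j\<in>UNIV. bergman_compl \<phi> (v j) z))\<^sup>2) \<and>
    (nrm \<phi> (\<lambda>z. \<Sum>j\<in>UNIV. bergman_compl \<phi> (v j) z))\<^sup>2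
      = (nrm \<phi> V)\<^sup>2 - (nrm \<phi> (bergman_proj \<phi> V))\<^sup>2"
proof -
  interpret smooth_weight \<phi> by unfold_locales (rule smooth_imp_C2[OF smooth])
  have uA2: "u {j} \<in> A2 \<phi>" for j
  proof -
    have "if card {j} = 1 then u {j} \<in> A2 \<phi> else u {j} = (\<lambda>z. 0)"
      using u unfolding A2_form_def by blast
    then show ?thesis by simp
  qed
  let ?R = "\<lambda>j. bergman_compl \<phi> (v j)"
  let ?S = "\<lambda>z. \<Sum>j\<in>UNIV. ?R j z"
  have R: "?R j \<in> L2 \<phi>" for j by (rule bergman_compl_L2[OF v_L2])
  have Q: "Q = (\<Sum>j\<in>UNIV. \<Sum>k\<in>UNIV. ip \<phi> (?R j) (v k))"
    unfolding Q_def bergman_compl_def ..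
  have RR: "ip \<phi> (?R j) (?R k) = ip \<phi> (?R j) (v k)" for j k
  proof -
    have "ip \<phi> (?R j) (?R k) = ip \<phi> (?R j) (v k) - ip \<phi> (?R j) (bergman_proj \<phi> (v k))"
      unfolding bergman_compl_def[of \<phi> "v k"]
      by (rule ip_diff_right[OF v_L2 A2_L2[OF bergman_proj_A2[OF v_L2]] R])
    then show ?thesis by (simp add: bergman_compl_orthogonal v_L2 bergman_proj_A2)
  qed
  have "complex_of_real ((nrm \<phi> ?S)\<^sup>2) = ip \<phi> ?S ?S" by (rule ip_self[symmetric])
  also have "\<dots> = (\<Sum>j\<in>UNIV. ip \<phi> (?R j) ?S)"
    by (intro ip_sum_left R L2_sum)
  also have "\<dots> = (\<Sum>j\<in>UNIV. \<Sum>k\<in>UNIV. ip \<phi> (?R j) (?R k))"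
    by (intro sum.cong refl ip_sum_right R)
  finally have norm: "Q = complex_of_real ((nrm \<phi> ?S)\<^sup>2)" by (simp only: RR Q)
  have V: "V \<in> L2 \<phi>" unfolding V_def by (rule L2_sum[OF v_L2])
  \<comment> \<open>Additivity of the projection reduces the last equality to Pythagoras for the
    single function \<open>V\<close>.\<close>
  have S: "?S = bergman_compl \<phi> V"
    unfolding bergman_compl_def V_def bergman_proj_sum[OF v_L2] by (simp add: sum_subtractf)
  have pyth: "(nrm \<phi> ?S)\<^sup>2 = (nrm \<phi> V)\<^sup>2 - (nrm \<phi> (bergman_proj \<phi> V))\<^sup>2"
    unfolding S by (rule bergman_compl_pythagoras[OF V])
  have comm: "Q = (\<Sum>j\<in>UNIV. \<Sum>k\<in>UNIV.
             ip \<phi> (commutator (dz k) (mult_op (phibar \<phi> j)) (u {j})) (u {k}))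
        - (\<Sum>j\<in>UNIV. \<Sum>k\<in>UNIV.
             ip \<phi> (commutator (dz k) (bergman_proj \<phi> \<circ> mult_op (phibar \<phi> j)) (u {j})) (u {k}))"
    if h: "\<forall>j k. mult_op (phibar \<phi> j) (dz k (u {j})) \<in> L2 \<phi> \<and>
            ip_exists \<phi> (commutator (dz k) (bergman_proj \<phi> \<circ> mult_op (phibar \<phi> j)) (u {j})) (u {k})"
    unfolding Q sum_subtractf[symmetric] v_def
    by (intro sum.cong refl ip_bergman_compl_eq_commutators psh uA2 v_L2[unfolded v_def])
       (use h in auto)
  have "Q \<in> \<real> \<and> 0 \<le> Re Q" unfolding norm by simp
  then show ?thesis using norm pyth comm by blast
qed

end
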